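(* Let $X$ be a compact complex manifold of complex dimension $n$. For all $p,q$ there is a decomposition (isomorphism of complex vector spaces) $$\ker\left(\partial:H^{p,q}_{\bar\partial}\to H^{p+1,q}_{\bar\partial}\right)\cong\left(G^{p,q}_{\partial}\sqcap\left(H^{p,q}_{\bar\partial}/\operatorname{im}(\partial)\right)\right)\oplus K^{p,q}\oplus\partial L^{p-1,q}_{\partial}.$$
   Context: On smooth complex-valued $(p,q)$-forms on $X$, define $H^{p,q}_A=\ker(\partial\bar\partial)/(\operatorname{im}(\partial)+\operatorname{im}(\bar\partial))$, $H^{p,q}_{\bar\partial}=\ker(\bar\partial)/\operatorname{im}(\bar\partial)$, $H^{p,q}_{\partial}=\ker(\partial)/\operatorname{im}(\partial)$ and $$K^{p,q}=\frac{\ker(\partial)\cap\ker(\bar\partial)}{\operatorname{im}(\partial)\cap\ker(\bar\partial)+\operatorname{im}(\bar\partial)\cap\ker(\partial)}$$ (all spaces in bidegree $(p,q)$, zero outside the range $0\le p,q\le n$). The map $\partial$ on Dolbeault cohomology is $[\theta]_{\bar\partial}\mapsto[\partial\theta]_{\bar\partial}$. Set $\mathcal G^{p,q}_{\partial}=\ker(\partial:H^{p,q}_A\to H^{p+1,q}_{\bar\partial},\ [\theta]_A\mapsto[\partial\theta]_{\bar\partial})$, $G^{p,q}_{\partial}=\mathcal G^{p,q}_{\partial}/\operatorname{im}(H^{p,q}_{\partial}\to H^{p,q}_A)$ and $L^{p,q}_{\partial}=H^{p,q}_A/\mathcal G^{p,q}_{\partial}$. $\partial L^{p-1,q}_{\partial}$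 denotes the (injective) image of $L^{p-1,q}_{\partial}$ in $H^{p,q}_{\bar\partial}$ under $\partial$. Write $\mathcal H^{p,q}_{\bar\partial}=H^{p,q}_{\bar\partial}/\operatorname{im}(\partial)$ and $\mathcal H^{p,q}_{\partial}=H^{p,q}_{\partial}/\operatorname{im}(\bar\partial)$ for the images of $H^{p,q}_{\bar\partial}$ and $H^{p,q}_{\partial}$ in $H^{p,q}_A$ under the natural maps; inside $H^{p,q}_A$ one has $\mathcal H^{p,q}_{\bar\partial}\cap\mathcal H^{p,q}_{\partial}=K^{p,q}$. By definition $$G^{p,q}_{\partial}\sqcap\left(H^{p,q}_{\bar\partial}/\operatorname{im}(\partial)\right)=\left(\mathcal H^{p,q}_{\bar\partial}\cap\mathcal G^{p,q}_{\partial}\right)/\left(\mathcal H^{p,q}_{\bar\partial}\cap\mathcal H^{p,q}_{\partial}\right).$$ *)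

theory Defs
  imports "HOL-Analysis.Analysis" "HOL-Algebra.Module" "HOL-Algebra.AbelCoset"
begin

section \<open>Smooth and holomorphic functions on open subsets of complex n-space\<close>

primrec Ck_on :: "nat \<Rightarrow> 'a::real_normed_vector set \<Rightarrow> ('a \<Rightarrow> 'b::real_normed_vector) \<Rightarrow> bool"
where
  "Ck_on 0 S f \<longleftrightarrow> continuous_on S f"
| "Ck_on (Suc k) S f \<longleftrightarrow>
     (\<forall>x\<in>S. f differentiable (at x)) \<and> (\<forall>v. Ck_on k S (\<lambda>x. frechet_derivative f (at x) v))"

definition smooth_on :: "'a::real_normed_vector set \<Rightarrow> ('a \<Rightarrow> 'b::real_normed_vector) \<Rightarrow> bool"
where
  "smooth_on S f \<longleftrightarrow> (\<forall>k. Ck_on k S f)"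

text \<open>The Wirtinger operators \<open>\<partial>/\<partial>z\<^sub>i\<close> and their conjugates. With \<open>z\<^sub>i = x\<^sub>i + \<i> y\<^sub>i\<close>, the real
  partial derivatives along \<open>x\<^sub>i\<close> and \<open>y\<^sub>i\<close> are the directional derivatives along
  \<open>axis i 1\<close> and \<open>axis i \<i>\<close>.\<close>

definition d_z :: "'n \<Rightarrow> (complex^'n::finite \<Rightarrow> complex) \<Rightarrow> complex^'n \<Rightarrow> complex" where
  "d_z i f z =
     (frechet_derivative f (at z) (axis i 1) - \<i> * frechet_derivative f (at z) (axis i \<i>)) / 2"

definition d_zbar :: "'n \<Rightarrow> (complex^'n::finite \<Rightarrow> complex) \<Rightarrow> complex^'n \<Rightarrow> complex" where
  "d_zbar i f z =
     (frechet_derivative f (at z) (axis i 1) + \<i> * frechet_derivative f (at z) (axis i \<i>)) / 2"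

text \<open>Smooth maps satisfying the Cauchy-Riemann equations in each variable.\<close>

definition holomorphic_map_on ::
  "(complex^'n::finite) set \<Rightarrow> (complex^'n \<Rightarrow> complex^'m::finite) \<Rightarrow> bool"
where
  "holomorphic_map_on S f \<longleftrightarrow>
     smooth_on S f \<and> (\<forall>z\<in>S. \<forall>i j. d_zbar i (\<lambda>w. f w $ j) z = 0)"


section \<open>Compact complex manifolds\<close>

text \<open>A chart is its domain together with the coordinate map; values of the coordinate map
  outside the domain are irrelevant.\<close>

type_synonym ('a, 'n) chart = "'a set \<times> ('a \<Rightarrow> complex^'n)"

definition transition :: "('a, 'n) chart \<Rightarrow> ('a, 'n) chart \<Rightarrow> complex^'n \<Rightarrow> complex^'n" where
  "transition c d = snd d \<circ> inv_into (fst c) (snd c)"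

definition complex_chart :: "'a topology \<Rightarrow> ('a, 'n::finite) chart \<Rightarrow> bool" where
  "complex_chart X = (\<lambda>(U, \<phi>). openin X U \<and> open (\<phi> ` U) \<and>
     homeomorphic_map (subtopology X U) (top_of_set (\<phi> ` U)) \<phi>)"

definition holomorphic_atlas :: "'a topology \<Rightarrow> ('a, 'n::finite) chart set \<Rightarrow> bool" where
  "holomorphic_atlas X \<A> \<longleftrightarrow>
     (\<forall>c\<in>\<A>. complex_chart X c) \<and> (\<Union>c\<in>\<A>. fst c) = topspace X \<and>
     (\<forall>c\<in>\<A>. \<forall>d\<in>\<A>. holomorphic_map_on (snd c ` (fst c \<inter> fst d)) (transition c d))"

definition compact_complex_manifold :: "'a topology \<Rightarrow> ('a, 'n::finite) chart set \<Rightarrow> bool" where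
  "compact_complex_manifold X \<A> \<longleftrightarrow>
     Hausdorff_space X \<and> second_countable X \<and> compact_space X \<and> holomorphic_atlas X \<A>"


section \<open>Smooth forms of bidegree (p,q)\<close>

text \<open>A differential form is given by its coordinate expressions in the charts of the atlas: a
  \<open>k\<close>-form assigns to a chart, to a point of the image of the chart and to a list of \<open>k\<close> tangent
  vectors in that chart a complex number. To make equality of forms the equality of functions,
  it is \<open>0\<close> on all other arguments.\<close>

type_synonym ('a, 'n) form = "('a, 'n) chart \<Rightarrow> complex^'n \<Rightarrow> (complex^'n) list \<Rightarrow> complex"

text \<open>The wedge product of a list of complex-valued covectors, normalised as the determinant of
  the matrix of their values.\<close>

definition wedge :: "('v \<Rightarrow> complex) list \<Rightarrow> 'v list \<Rightarrow> complex" where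
  "wedge \<alpha>s vs = (if length vs = length \<alpha>s
     then (\<Sum>\<sigma> | \<sigma> permutes {..<length \<alpha>s}.
             of_int (sign \<sigma>) * (\<Prod>i<length \<alpha>s. (\<alpha>s ! i) (vs ! \<sigma> i)))
     else 0)"

text \<open>The wedge product of the \<open>dz\<^sub>i\<close>, \<open>i\<close> in \<open>I\<close>, followed by the conjugates of the \<open>dz\<^sub>j\<close>, \<open>j\<close>
  in \<open>J\<close>. Multi-indices are arbitrary lists, as the index type carries no order; sums over all
  of them instead of the increasing ones span the same forms.\<close>

definition dz_dzbar :: "'n list \<Rightarrow> 'n list \<Rightarrow> (complex^'n) list \<Rightarrow> complex" where
  "dz_dzbar I J = wedge (map (\<lambda>i v. v $ i) I @ map (\<lambda>j v. cnj (v $ j)) J)"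

definition local_form ::
  "nat \<Rightarrow> nat \<Rightarrow> (complex^'n::finite) set \<Rightarrow> (complex^'n \<Rightarrow> (complex^'n) list \<Rightarrow> complex) \<Rightarrow> bool"
where
  "local_form p q S \<eta> \<longleftrightarrow>
     (\<exists>f. (\<forall>I J. length I = p \<longrightarrow> length J = q \<longrightarrow> smooth_on S (f I J)) \<and>
          (\<forall>z\<in>S. \<forall>vs. \<eta> z vs =
             (\<Sum>I | length I = p. \<Sum>J | length J = q. f I J z * dz_dzbar I J vs))) \<and>
     (\<forall>z. z \<notin> S \<longrightarrow> (\<forall>vs. \<eta> z vs = 0))"

text \<open>The coordinate expressions in two charts are related by pullback along the transition map.
  The spaces vanish for negative \<open>p\<close> or \<open>q\<close> by convention; for \<open>p\<close> or \<open>q\<close> exceeding the dimension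
  they vanish because every \<open>dz_dzbar I J\<close> then has a repeated factor.\<close>

definition forms :: "('a, 'n::finite) chart set \<Rightarrow> int \<Rightarrow> int \<Rightarrow> ('a, 'n) form set" where
  "forms \<A> p q = (if p < 0 \<or> q < 0 then {\<lambda>c z vs. 0} else
     {\<omega>. (\<forall>c. c \<notin> \<A> \<longrightarrow> \<omega> c = (\<lambda>z vs. 0)) \<and>
         (\<forall>c\<in>\<A>. local_form (nat p) (nat q) (snd c ` fst c) (\<omega> c)) \<and>
         (\<forall>c\<in>\<A>. \<forall>d\<in>\<A>. \<forall>x\<in>fst c \<inter> fst d. \<forall>vs.
            \<omega> c (snd c x) vs =
            \<omega> d (snd d x) (map (frechet_derivative (transition c d) (at (snd c x))) vs))})"

definition omit :: "nat \<Rightarrow> 'v list \<Rightarrow> 'v list" where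
  "omit j vs = take j vs @ drop (Suc j) vs"

text \<open>In each chart \<open>\<partial>\<omega> = (\<Sum>i. dz\<^sub>i \<and> \<partial>\<omega>/\<partial>z\<^sub>i)\<close>, the derivatives being taken coefficientwise and
  the wedge product with \<open>dz\<^sub>i\<close> being expanded along its first factor; similarly for \<open>delbar\<close>.\<close>

definition del :: "('a, 'n::finite) form \<Rightarrow> ('a, 'n) form" where
  "del \<omega> = (\<lambda>c z vs. if z \<in> snd c ` fst c
     then (\<Sum>j<length vs. (-1) ^ j *
             (\<Sum>i\<in>UNIV. (vs ! j) $ i * d_z i (\<lambda>w. \<omega> c w (omit j vs)) z))
     else 0)"

definition delbar :: "('a, 'n::finite) form \<Rightarrow> ('a, 'n) form" where
  "delbar \<omega> = (\<lambda>c z vs. if z \<in> snd c ` fst c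
     then (\<Sum>j<length vs. (-1) ^ j *
             (\<Sum>i\<in>UNIV. cnj ((vs ! j) $ i) * d_zbar i (\<lambda>w. \<omega> c w (omit j vs)) z))
     else 0)"


section \<open>Complex vector spaces, quotients and direct sums\<close>

text \<open>Vector spaces are \<open>module\<close> records with scalars in \<^typ>\<open>complex\<close>. The ring slots \<open>mult\<close> and
  \<open>one\<close> of these records carry no meaning for modules. A subspace with carrier \<open>S\<close> is written
  \<open>M\<lparr>carrier := S\<rparr>\<close>.\<close>

type_synonym 'b cspace = "(complex, 'b) module"

definition quot_space :: "'b cspace \<Rightarrow> 'b set \<Rightarrow> 'b set cspace" where
  "quot_space M W = \<lparr>carrier = a_rcosets\<^bsub>M\<^esub> W, mult = undefined, one = undefined,
     zero = W, add = set_add M, smult = (\<lambda>c A. \<Union>a\<in>A. W +>\<^bsub>M\<^esub> (c \<odot>\<^bsub>M\<^esub> a))\<rparr>"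

definition direct_sum :: "'b cspace \<Rightarrow> 'c cspace \<Rightarrow> ('b \<times> 'c) cspace" (infixr "\<oplus>\<^sub>v" 65) where
  "direct_sum M N = \<lparr>carrier = carrier M \<times> carrier N, mult = undefined, one = undefined,
     zero = (\<zero>\<^bsub>M\<^esub>, \<zero>\<^bsub>N\<^esub>),
     add = (\<lambda>(a, b) (a', b'). (a \<oplus>\<^bsub>M\<^esub> a', b \<oplus>\<^bsub>N\<^esub> b')),
     smult = (\<lambda>c (a, b). (c \<odot>\<^bsub>M\<^esub> a, c \<odot>\<^bsub>N\<^esub> b))\<rparr>"

definition space_iso :: "'b cspace \<Rightarrow> 'c cspace \<Rightarrow> bool" (infix "\<cong>\<^sub>v" 50) where
  "M \<cong>\<^sub>v N \<longleftrightarrow> (\<exists>h. bij_betw h (carrier M) (carrier N) \<and>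
     (\<forall>x\<in>carrier M. \<forall>y\<in>carrier M. h (x \<oplus>\<^bsub>M\<^esub> y) = h x \<oplus>\<^bsub>N\<^esub> h y) \<and>
     (\<forall>c. \<forall>x\<in>carrier M. h (c \<odot>\<^bsub>M\<^esub> x) = c \<odot>\<^bsub>N\<^esub> h x))"

text \<open>The map on cosets induced by a map \<open>f\<close> that is constant on each coset.\<close>

definition induced :: "('b \<Rightarrow> 'c) \<Rightarrow> 'b set \<Rightarrow> 'c" where
  "induced f = (\<lambda>A. the_elem (f ` A))"

definition form_space :: "('a, 'n) form cspace" where
  "form_space = \<lparr>carrier = UNIV, mult = undefined, one = undefined,
     zero = (\<lambda>c z vs. 0),
     add = (\<lambda>\<omega> \<eta> c z vs. \<omega> c z vs + \<eta> c z vs),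
     smult = (\<lambda>a \<omega> c z vs. a * \<omega> c z vs)\<rparr>"


section \<open>Cohomology spaces\<close>

definition ker_del :: "('a, 'n::finite) chart set \<Rightarrow> int \<Rightarrow> int \<Rightarrow> ('a, 'n) form set" where
  "ker_del \<A> p q = {\<omega> \<in> forms \<A> p q. del \<omega> = \<zero>\<^bsub>form_space\<^esub>}"

definition ker_delbar :: "('a, 'n::finite) chart set \<Rightarrow> int \<Rightarrow> int \<Rightarrow> ('a, 'n) form set" where
  "ker_delbar \<A> p q = {\<omega> \<in> forms \<A> p q. delbar \<omega> = \<zero>\<^bsub>form_space\<^esub>}"

definition ker_del_delbar :: "('a, 'n::finite) chart set \<Rightarrow> int \<Rightarrow> int \<Rightarrow> ('a, 'n) form set" where
  "ker_del_delbar \<A> p q = {\<omega> \<in> forms \<A> p q. del (delbar \<omega>) = \<zero>\<^bsub>form_space\<^esub>}"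

definition im_del :: "('a, 'n::finite) chart set \<Rightarrow> int \<Rightarrow> int \<Rightarrow> ('a, 'n) form set" where
  "im_del \<A> p q = del ` forms \<A> (p - 1) q"

definition im_delbar :: "('a, 'n::finite) chart set \<Rightarrow> int \<Rightarrow> int \<Rightarrow> ('a, 'n) form set" where
  "im_delbar \<A> p q = delbar ` forms \<A> p (q - 1)"

definition H_delbar :: "('a, 'n::finite) chart set \<Rightarrow> int \<Rightarrow> int \<Rightarrow> ('a, 'n) form set cspace" where
  "H_delbar \<A> p q = quot_space (form_space\<lparr>carrier := ker_delbar \<A> p q\<rparr>) (im_delbar \<A> p q)"

definition H_del :: "('a, 'n::finite) chart set \<Rightarrow> int \<Rightarrow> int \<Rightarrow> ('a, 'n) form set cspace" where
  "H_del \<A> p q = quot_space (form_space\<lparr>carrier := ker_del \<A> p q\<rparr>) (im_del \<A> p q)"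

definition H_A :: "('a, 'n::finite) chart set \<Rightarrow> int \<Rightarrow> int \<Rightarrow> ('a, 'n) form set cspace" where
  "H_A \<A> p q = quot_space (form_space\<lparr>carrier := ker_del_delbar \<A> p q\<rparr>)
     (im_del \<A> p q <+>\<^bsub>form_space\<^esub> im_delbar \<A> p q)"

definition K_space :: "('a, 'n::finite) chart set \<Rightarrow> int \<Rightarrow> int \<Rightarrow> ('a, 'n) form set cspace" where
  "K_space \<A> p q = quot_space (form_space\<lparr>carrier := ker_del \<A> p q \<inter> ker_delbar \<A> p q\<rparr>)
     ((im_del \<A> p q \<inter> ker_delbar \<A> p q) <+>\<^bsub>form_space\<^esub> (im_delbar \<A> p q \<inter> ker_del \<A> p q))"

definition class_delbar ::
  "('a, 'n::finite) chart set \<Rightarrow> int \<Rightarrow> int \<Rightarrow> ('a, 'n) form \<Rightarrow> ('a, 'n) form set" where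
  "class_delbar \<A> p q \<theta> = im_delbar \<A> p q +>\<^bsub>form_space\<^esub> \<theta>"

definition class_A ::
  "('a, 'n::finite) chart set \<Rightarrow> int \<Rightarrow> int \<Rightarrow> ('a, 'n) form \<Rightarrow> ('a, 'n) form set" where
  "class_A \<A> p q \<theta> = (im_del \<A> p q <+>\<^bsub>form_space\<^esub> im_delbar \<A> p q) +>\<^bsub>form_space\<^esub> \<theta>"

text \<open>The map \<open>[\<theta>] \<mapsto> [\<partial>\<theta>]\<close> into the Dolbeault cohomology of bidegree \<open>(p + 1, q)\<close>, both from
  \<open>H_delbar \<A> p q\<close> and from \<open>H_A \<A> p q\<close>.\<close>

definition del_class ::
  "('a, 'n::finite) chart set \<Rightarrow> int \<Rightarrow> int \<Rightarrow> ('a, 'n) form set \<Rightarrow> ('a, 'n) form set" where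
  "del_class \<A> p q = induced (\<lambda>\<theta>. class_delbar \<A> (p + 1) q (del \<theta>))"

definition ker_del_H_delbar ::
  "('a, 'n::finite) chart set \<Rightarrow> int \<Rightarrow> int \<Rightarrow> ('a, 'n) form set cspace" where
  "ker_del_H_delbar \<A> p q = (H_delbar \<A> p q)\<lparr>carrier :=
     {a \<in> carrier (H_delbar \<A> p q). del_class \<A> p q a = \<zero>\<^bsub>H_delbar \<A> (p + 1) q\<^esub>}\<rparr>"

definition cal_G_del ::
  "('a, 'n::finite) chart set \<Rightarrow> int \<Rightarrow> int \<Rightarrow> ('a, 'n) form set set" where
  "cal_G_del \<A> p q =
     {a \<in> carrier (H_A \<A> p q). del_class \<A> p q a = \<zero>\<^bsub>H_delbar \<A> (p + 1) q\<^esub>}"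

definition L_del ::
  "('a, 'n::finite) chart set \<Rightarrow> int \<Rightarrow> int \<Rightarrow> ('a, 'n) form set set cspace" where
  "L_del \<A> p q = quot_space (H_A \<A> p q) (cal_G_del \<A> p q)"

definition del_L_del ::
  "('a, 'n::finite) chart set \<Rightarrow> int \<Rightarrow> int \<Rightarrow> ('a, 'n) form set cspace" where
  "del_L_del \<A> p q = (H_delbar \<A> (p + 1) q)\<lparr>carrier :=
     induced (del_class \<A> p q) ` carrier (L_del \<A> p q)\<rparr>"

definition cal_H_delbar ::
  "('a, 'n::finite) chart set \<Rightarrow> int \<Rightarrow> int \<Rightarrow> ('a, 'n) form set set" where
  "cal_H_delbar \<A> p q = induced (class_A \<A> p q) ` carrier (H_delbar \<A> p q)"

definition cal_H_del ::
  "('a, 'n::finite) chart set \<Rightarrow> int \<Rightarrow> int \<Rightarrow> ('a, 'n) form set set" where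
  "cal_H_del \<A> p q = induced (class_A \<A> p q) ` carrier (H_del \<A> p q)"

definition G_del_sqcap_H_delbar ::
  "('a, 'n::finite) chart set \<Rightarrow> int \<Rightarrow> int \<Rightarrow> ('a, 'n) form set set cspace" where
  "G_del_sqcap_H_delbar \<A> p q =
     quot_space ((H_A \<A> p q)\<lparr>carrier := cal_H_delbar \<A> p q \<inter> cal_G_del \<A> p q\<rparr>)
       (cal_H_delbar \<A> p q \<inter> cal_H_del \<A> p q)"

end

theory Submission
  imports Defs "Jordan_Normal_Form.Determinant" "HOL-Library.Function_Algebras"
begin

text \<open>
  Both sides are subquotients of the smooth forms. Let \<open>N\<close> be the \<open>\<partial>\<close>bar-closed forms \<open>\<theta>\<close> with
  \<open>\<partial>\<theta>\<close> in the image of \<open>\<partial>\<close>bar, let \<open>C\<close> be the sum of the image of \<open>\<partial>\<close>bar and of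
  \<open>\<partial>(ker \<partial>\<partial>bar)\<close>, and let \<open>D\<close> be the sum of \<open>C\<close> and of the forms closed under both operators. The
  kernel on the left is \<open>N\<close> modulo the image of \<open>\<partial>\<close>bar, and the filtration \<open>im \<partial>bar \<subseteq> C \<subseteq> D \<subseteq> N\<close>
  has the three summands on the right as its graded pieces: \<open>C / im \<partial>bar\<close> is \<open>\<partial>L\<close>, \<open>D / C\<close> is \<open>K\<close>,
  and \<open>C\<close> is the kernel of \<open>N \<rightarrow> H_A\<close>, so that \<open>N / D\<close> is the first summand. Linear projections
  split the filtration.

  This uses that the forms are a double complex. Invariance of \<open>\<partial>\<close> and \<open>\<partial>\<close>bar under a holomorphic
  coordinate change holds because the second derivatives of the transition map are symmetric while
  forms are alternating, so the second-order terms cancel in pairs; the identities \<open>\<partial>\<partial> = 0\<close> and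
  \<open>\<partial>\<partial>bar = - \<partial>bar\<partial>\<close> combine symmetry of second derivatives with antisymmetry of the wedge product.
\<close>

text \<open>The cohomology spaces are nested quotients, with sets or sets of sets of forms as
  elements, so they do not all live in one type. \<open>presents\<close> brings them to one level: a
  space is described by a map from a subspace \<open>V\<close> of the forms and by a subspace
  deciding when two forms have the same image; spaces presented by the same pair are isomorphic.
  What remains is a chain of subspaces of forms. Its splitting chooses bases, so the isomorphism is
  not canonical. The kernel of \<open>N\<close> in \<open>H_A\<close> is \<open>C\<close> for this
  reason: if \<partial>a + y is \<partial>bar-closed and y is \<partial>bar-exact, then
  \<partial>bar\<partial>a = 0, so a lies in ker \<partial>\<partial>bar. Sums over all
  multi-indices do not determine their coefficients. Hence the operators act on the values of a form
  at lists of vectors, expansions with coefficients are chosen only where needed, and no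
  independence of the choice has to be shown.\<close>

no_notation Matrix.vec_index (infixl "$" 100)
hide_const (open) Determinants.det

section \<open>The wedge product as a determinant\<close>

text \<open>The Leibniz sum of \<open>wedge\<close> is that of \<open>det\<close>, so Laplace
  expansion, transposition and row permutation can be used. The matrices carry their size as a
  number and not as a type, because the degree of a form varies.\<close>

lemma wedge_eq_det:
  assumes "length \<alpha>s = n" "length vs = n"
  shows "wedge \<alpha>s vs = det (mat n n (\<lambda>(i, j). (\<alpha>s ! i) (vs ! j)))"
proof -
  have "(\<Prod>i<n. (\<alpha>s ! i) (vs ! \<sigma> i)) = (\<Prod>i = 0..<n. mat n n (\<lambda>(i, j). (\<alpha>s ! i) (vs ! j)) $$ (i, \<sigma> i))"
    if "\<sigma> permutes {0..<n}" for \<sigma>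
  proof -
    have "\<sigma> i < n" if "i < n" for i
      using permutes_in_image[OF \<open>\<sigma> permutes {0..<n}\<close>, of i] that by simp
    then show ?thesis
      by (intro prod.cong) auto
  qed
  then show ?thesis
    using assms by (subst det_def'[of _ n]) (auto simp: wedge_def lessThan_atLeast0 intro!: sum.cong)
qed

lemma length_omit [simp]: "j < length vs \<Longrightarrow> length (omit j vs) = length vs - 1"
  by (simp add: omit_def)

lemma nth_omit:
  "j < length vs \<Longrightarrow> i < length vs - 1 \<Longrightarrow> omit j vs ! i = vs ! (if i < j then i else Suc i)"
  by (auto simp: omit_def nth_append min_def)

text \<open>Laplace expansion along the first row. The alternating sum over \<open>omit\<close> has
  the shape in which \<open>del\<close> and \<open>delbar\<close> are defined, so in an expansion
  these operators prepend a covector.\<close>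

lemma wedge_Cons:
  "wedge (\<alpha> # \<alpha>s) vs = (\<Sum>j<length vs. (-1) ^ j * (\<alpha> (vs ! j) * wedge \<alpha>s (omit j vs)))"
proof (cases "length vs = Suc (length \<alpha>s)")
  case True
  let ?n = "length \<alpha>s"
  let ?A = "mat (Suc ?n) (Suc ?n) (\<lambda>(i, j). ((\<alpha> # \<alpha>s) ! i) (vs ! j))"
  have "wedge (\<alpha> # \<alpha>s) vs = det ?A"
    using True by (intro wedge_eq_det) auto
  also have "\<dots> = (\<Sum>j<Suc ?n. ?A $$ (0, j) * cofactor ?A 0 j)"
    by (rule laplace_expansion_row) auto
  also have "\<dots> = (\<Sum>j<Suc ?n. (-1) ^ j * (\<alpha> (vs ! j) * wedge \<alpha>s (omit j vs)))"
  proof (intro sum.cong refl)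
    fix j assume "j \<in> {..<Suc ?n}"
    then have j: "j < Suc ?n" by simp
    have "mat_delete ?A 0 j = mat ?n ?n (\<lambda>(i, k). (\<alpha>s ! i) (omit j vs ! k))"
      using j True by (intro eq_matI) (auto simp: mat_delete_def nth_omit)
    then have "det (mat_delete ?A 0 j) = wedge \<alpha>s (omit j vs)"
      using j True by (subst wedge_eq_det[of _ ?n]) auto
    then show "?A $$ (0, j) * cofactor ?A 0 j = (-1) ^ j * (\<alpha> (vs ! j) * wedge \<alpha>s (omit j vs))"
      using j by (simp add: cofactor_def)
  qed
  finally show ?thesis using True by simp
next
  case False
  have "wedge \<alpha>s (omit j vs) = 0" if "j < length vs" for j
    using that False by (auto simp: wedge_def)
  then show ?thesis using False by (simp add: wedge_def)
qed

text \<open>Each vector becomes its evaluation functional on covectors; in this way a law for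
  covectors carries over to vectors.\<close>

lemma wedge_transpose:
  "length \<alpha>s = length vs \<Longrightarrow> wedge (map (\<lambda>v \<alpha>. \<alpha> v) vs) \<alpha>s = wedge \<alpha>s vs"
proof -
  assume len: "length \<alpha>s = length vs"
  let ?n = "length vs"
  let ?A = "mat ?n ?n (\<lambda>(i, j). (\<alpha>s ! i) (vs ! j))"
  have "transpose_mat ?A = mat ?n ?n (\<lambda>(i, j). (map (\<lambda>v \<alpha>. \<alpha> v) vs ! i) (\<alpha>s ! j))"
    by (intro eq_matI) auto
  then show ?thesis
    using len det_transpose[of ?A ?n] by (simp add: wedge_eq_det[of _ ?n])
qed

text \<open>Exchanging two adjacent rows of the determinant. The other sign rules, for moving a
  covector or a vector over several others, are reduced to this one.\<close>

lemma wedge_swap: "wedge (\<beta>s @ [\<alpha>, \<alpha>'] @ \<gamma>s) vs = - wedge (\<beta>s @ [\<alpha>', \<alpha>] @ \<gamma>s) vs"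
proof (cases "length vs = length \<beta>s + length \<gamma>s + 2")
  case True
  let ?n = "length vs" and ?k = "length \<beta>s"
  let ?L = "\<beta>s @ [\<alpha>, \<alpha>'] @ \<gamma>s" and ?R = "\<beta>s @ [\<alpha>', \<alpha>] @ \<gamma>s"
  let ?B = "mat ?n ?n (\<lambda>(i, j). (?R ! i) (vs ! j))"
  let ?\<tau> = "Transposition.transpose ?k (Suc ?k)"
  have perm: "?\<tau> permutes {0..<?n}"
    using True by (intro permutes_swap_id) auto
  have nth: "?L ! i = ?R ! (?\<tau> i)" for i
  proof -
    consider "i < ?k" | "i = ?k" | "i = Suc ?k" | "i > Suc ?k" by linarith
    then show ?thesis
    proof cases
      case 4
      then obtain m where "i = ?k + Suc (Suc m)"
        by (metis add_Suc_right add_Suc less_imp_Suc_add)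
      then show ?thesis by (simp add: Transposition.transpose_def nth_append)
    qed (auto simp: Transposition.transpose_def nth_append)
  qed
  have lt: "?\<tau> i < ?n" if "i < ?n" for i
    using permutes_in_image[OF perm, of i] that by simp
  have "wedge ?L vs = det (mat ?n ?n (\<lambda>(i, j). (?L ! i) (vs ! j)))"
    using True by (intro wedge_eq_det) auto
  also have "mat ?n ?n (\<lambda>(i, j). (?L ! i) (vs ! j)) = mat ?n ?n (\<lambda>(i, j). ?B $$ (?\<tau> i, j))"
    using lt by (intro eq_matI) (auto simp only: nth index_mat dim_row_mat dim_col_mat prod.case)
  also have "det \<dots> = signof ?\<tau> * det ?B"
    using perm by (intro det_permute_rows) auto
  also have "\<dots> = - wedge ?R vs"
    using True by (subst wedge_eq_det[of ?R ?n vs]) (auto simp: sign_swap_id)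
  finally show ?thesis .
next
  case False
  then show ?thesis by (simp add: wedge_def)
qed

lemma wedge_move:
  "wedge (\<beta>s @ [\<alpha>] @ \<gamma>s @ \<delta>s) vs = (-1) ^ length \<gamma>s * wedge (\<beta>s @ \<gamma>s @ [\<alpha>] @ \<delta>s) vs"
proof (induction \<gamma>s arbitrary: \<beta>s)
  case (Cons \<gamma> \<gamma>s)
  show ?case
    using wedge_swap[of \<beta>s \<alpha> \<gamma> "\<gamma>s @ \<delta>s" vs] Cons[of "\<beta>s @ [\<gamma>]"] by simp
qed simp

lemma wedge_move_vector:
  "wedge \<alpha>s (us @ [v] @ vs @ ws) = (-1) ^ length vs * wedge \<alpha>s (us @ vs @ [v] @ ws)"
proof (cases "length \<alpha>s = length (us @ [v] @ vs @ ws)")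
  case True
  let ?ev = "map (\<lambda>v \<alpha>. \<alpha> v) :: _ list \<Rightarrow> ((_ \<Rightarrow> complex) \<Rightarrow> complex) list"
  have "wedge \<alpha>s (us @ [v] @ vs @ ws) = wedge (?ev us @ [\<lambda>\<alpha>. \<alpha> v] @ ?ev vs @ ?ev ws) \<alpha>s"
    using wedge_transpose[OF True] by simp
  also have "\<dots> = (-1) ^ length vs * wedge (?ev us @ ?ev vs @ [\<lambda>\<alpha>. \<alpha> v] @ ?ev ws) \<alpha>s"
    by (subst wedge_move) simp
  also have "wedge (?ev us @ ?ev vs @ [\<lambda>\<alpha>. \<alpha> v] @ ?ev ws) \<alpha>s = wedge \<alpha>s (us @ vs @ [v] @ ws)"
    using wedge_transpose[of \<alpha>s "us @ vs @ [v] @ ws"] True by simp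
  finally show ?thesis .
next
  case False
  then show ?thesis by (simp add: wedge_def)
qed

section \<open>Smooth functions\<close>

lemma has_frechet_derivative:
  "f differentiable (at x) \<Longrightarrow> (f has_derivative frechet_derivative f (at x)) (at x)"
  by (simp add: frechet_derivative_works)

lemma frechet_derivative_eq: "(f has_derivative f') (at x) \<Longrightarrow> frechet_derivative f (at x) = f'"
  by (rule frechet_derivative_at[symmetric])

text \<open>A derivative at a point of an open set sees only values on that set. The inductions
  below use this to replace the derivative of a sum or a composite by a formula that is valid only
  on \<open>S\<close>.\<close>

lemma Ck_on_cong:
  "open S \<Longrightarrow> (\<And>x. x \<in> S \<Longrightarrow> f x = g x) \<Longrightarrow> Ck_on k S f \<Longrightarrow> Ck_on k S g"
proof (induction k arbitrary: f g)
  case 0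
  have "continuous_on S f = continuous_on S g"
    by (rule continuous_on_cong[OF refl 0(2)])
  then show ?case using 0(3) by simp
next
  case (Suc k)
  have f: "f differentiable (at x)" if "x \<in> S" for x
    using Suc.prems(3) that by simp
  have diff: "g differentiable (at x)" if "x \<in> S" for x
    using has_derivative_transform_within_open[OF has_frechet_derivative[OF f[OF that]]
        Suc.prems(1) that Suc.prems(2)]
    unfolding differentiable_def by blast
  have eq: "frechet_derivative f (at x) v = frechet_derivative g (at x) v" if "x \<in> S" for x v
    by (rule fun_cong[OF frechet_derivative_transform_within_open[OF f[OF that] Suc.prems(1) that
            Suc.prems(2)]])
  have "Ck_on k S (\<lambda>x. frechet_derivative f (at x) v)" for v
    using Suc.prems(3) by simp
  from Suc.IH[OF Suc.prems(1) eq this] diff show ?case by simp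
qed

lemma Ck_on_const: "Ck_on k S (\<lambda>x. c)"
  by (induction k arbitrary: c) simp_all

lemma Ck_on_add:
  "open S \<Longrightarrow> Ck_on k S f \<Longrightarrow> Ck_on k S g \<Longrightarrow> Ck_on k S (\<lambda>x. f x + g x)"
proof (induction k arbitrary: f g)
  case 0
  then show ?case by (simp add: continuous_on_add)
next
  case (Suc k)
  have D: "((\<lambda>x. f x + g x) has_derivative
      (\<lambda>v. frechet_derivative f (at x) v + frechet_derivative g (at x) v)) (at x)" if "x \<in> S" for x
    using Suc.prems that by (intro has_derivative_add has_frechet_derivative) auto
  have "Ck_on k S (\<lambda>x. frechet_derivative (\<lambda>x. f x + g x) (at x) v)" for v
    by (rule Ck_on_cong[OF Suc.prems(1) _ Suc.IH[OF Suc.prems(1),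
          of "\<lambda>x. frechet_derivative f (at x) v" "\<lambda>x. frechet_derivative g (at x) v"]])
      (use Suc.prems in \<open>auto simp: frechet_derivative_eq[OF D]\<close>)
  then show ?case using D by (auto simp: differentiable_def)
qed

lemma Ck_on_bounded_linear:
  assumes h: "bounded_linear h" and S: "open S"
  shows "Ck_on k S f \<Longrightarrow> Ck_on k S (\<lambda>x. h (f x))"
proof (induction k arbitrary: f)
  case 0
  then have "continuous_on S f" by simp
  from bounded_linear.continuous_on[OF h this] show ?case by (simp only: Ck_on.simps)
next
  case (Suc k)
  have f: "f differentiable (at x)" if "x \<in> S" for x
    using Suc.prems that by simp
  have D: "((\<lambda>x. h (f x)) has_derivative (\<lambda>v. h (frechet_derivative f (at x) v))) (at x)"
    if "x \<in> S" for x
    by (rule bounded_linear.has_derivative[OF h has_frechet_derivative[OF f[OF that]]])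
  have eq: "h (frechet_derivative f (at x) v) = frechet_derivative (\<lambda>x. h (f x)) (at x) v"
    if "x \<in> S" for x v
    by (simp only: frechet_derivative_eq[OF D[OF that]])
  have "Ck_on k S (\<lambda>x. frechet_derivative f (at x) v)" for v
    using Suc.prems by simp
  from Ck_on_cong[OF S eq Suc.IH[OF this]]
  have "Ck_on k S (\<lambda>x. frechet_derivative (\<lambda>x. h (f x)) (at x) v)" for v .
  moreover have "(\<lambda>x. h (f x)) differentiable (at x)" if "x \<in> S" for x
    using D[OF that] unfolding differentiable_def by blast
  ultimately show ?case by (simp only: Ck_on.simps) blast
qed

lemma smooth_on_const: "smooth_on S (\<lambda>x. c)"
  by (simp add: smooth_on_def Ck_on_const)

lemma smooth_on_add:
  "open S \<Longrightarrow> smooth_on S f \<Longrightarrow> smooth_on S g \<Longrightarrow> smooth_on S (\<lambda>x. f x + g x)"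
  by (simp add: smooth_on_def Ck_on_add)

lemma smooth_on_bounded_linear:
  "bounded_linear h \<Longrightarrow> open S \<Longrightarrow> smooth_on S f \<Longrightarrow> smooth_on S (\<lambda>x. h (f x))"
  unfolding smooth_on_def by (blast intro: Ck_on_bounded_linear)

lemma smooth_on_cmult:
  fixes f :: "'a::real_normed_vector \<Rightarrow> complex"
  shows "open S \<Longrightarrow> smooth_on S f \<Longrightarrow> smooth_on S (\<lambda>x. c * f x)"
  by (rule smooth_on_bounded_linear[OF bounded_linear_mult_right])

lemma smooth_on_continuous: "smooth_on S f \<Longrightarrow> continuous_on S f"
  using Ck_on.simps(1)[of S f] by (auto simp: smooth_on_def simp del: Ck_on.simps)

lemma smooth_on_differentiable: "smooth_on S f \<Longrightarrow> x \<in> S \<Longrightarrow> f differentiable (at x)"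
  using Ck_on.simps(2)[of _ S f] by (auto simp: smooth_on_def simp del: Ck_on.simps)

lemma smooth_on_frechet_derivative:
  "smooth_on S f \<Longrightarrow> smooth_on S (\<lambda>x. frechet_derivative f (at x) v)"
  using Ck_on.simps(2)[of _ S f] by (auto simp: smooth_on_def simp del: Ck_on.simps)

section \<open>Symmetry of second derivatives\<close>

lemma has_real_derivative_along_line:
  fixes f :: "'a::real_normed_vector \<Rightarrow> real"
  assumes "f differentiable (at (p + s *\<^sub>R u))"
  shows "((\<lambda>s. f (p + s *\<^sub>R u)) has_real_derivative frechet_derivative f (at (p + s *\<^sub>R u)) u) (at s)"
proof -
  note D = has_frechet_derivative[OF assms]
  have "((\<lambda>s. p + s *\<^sub>R u) has_derivative (\<lambda>h. h *\<^sub>R u)) (at s)"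
    by (auto intro!: derivative_eq_intros)
  from diff_chain_at[OF this D]
  have "((\<lambda>s. f (p + s *\<^sub>R u)) has_derivative
      (\<lambda>h. frechet_derivative f (at (p + s *\<^sub>R u)) (h *\<^sub>R u))) (at s)"
    by (simp add: o_def)
  moreover have "frechet_derivative f (at (p + s *\<^sub>R u)) (h *\<^sub>R u) =
      frechet_derivative f (at (p + s *\<^sub>R u)) u * h" for h
    using linear_cmul[OF has_derivative_linear[OF D]] by simp
  ultimately show ?thesis
    by (simp add: has_field_derivative_def)
qed

text \<open>The left-hand side is the second difference of \<open>f\<close> over the parallelogram
  at \<open>x\<close> with sides along \<open>u\<close> and \<open>v\<close>. The mean value theorem
  is applied twice: in direction \<open>u\<close>, and then in direction \<open>v\<close> to the
  derivative along \<open>u\<close>.\<close>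

lemma second_difference_mean_value:
  fixes f :: "'a::real_normed_vector \<Rightarrow> real"
  assumes sm: "smooth_on S f" and t: "0 < t"
    and S: "\<And>a b. 0 \<le> a \<Longrightarrow> a \<le> t \<Longrightarrow> 0 \<le> b \<Longrightarrow> b \<le> t \<Longrightarrow> x + a *\<^sub>R u + b *\<^sub>R v \<in> S"
  obtains a b where "0 \<le> a" "a \<le> t" "0 \<le> b" "b \<le> t"
    "f (x + t *\<^sub>R u + t *\<^sub>R v) - f (x + t *\<^sub>R u) - f (x + t *\<^sub>R v) + f x =
     t * t * frechet_derivative (\<lambda>w. frechet_derivative f (at w) u) (at (x + a *\<^sub>R u + b *\<^sub>R v)) v"
proof -
  let ?Du = "\<lambda>w. frechet_derivative f (at w) u"
  \<comment> \<open>\<open>g s\<close> compares the two sides parallel to \<open>u\<close>, so that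
    \<open>g t - g 0\<close> is the second difference.\<close>
  define g where "g = (\<lambda>s. f ((x + t *\<^sub>R v) + s *\<^sub>R u) - f (x + s *\<^sub>R u))"
  have "DERIV g s :> ?Du ((x + t *\<^sub>R v) + s *\<^sub>R u) - ?Du (x + s *\<^sub>R u)" if "0 \<le> s" "s \<le> t" for s
    unfolding g_def
    using S[of s t] S[of s 0] that t
    by (intro DERIV_diff has_real_derivative_along_line smooth_on_differentiable[OF sm])
      (simp_all add: algebra_simps)
  from MVT2[OF t this] obtain a where a: "0 < a" "a < t"
    and ga: "g t - g 0 = t * (?Du ((x + t *\<^sub>R v) + a *\<^sub>R u) - ?Du (x + a *\<^sub>R u))"
    by auto
  have "DERIV (\<lambda>s. ?Du ((x + a *\<^sub>R u) + s *\<^sub>R v)) s :>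
      frechet_derivative ?Du (at ((x + a *\<^sub>R u) + s *\<^sub>R v)) v" if "0 \<le> s" "s \<le> t" for s
    using S[of a s] that a
    by (intro has_real_derivative_along_line smooth_on_differentiable[OF smooth_on_frechet_derivative[OF sm]])
      simp
  from MVT2[OF t this] obtain b where b: "0 < b" "b < t"
    and gb: "?Du ((x + a *\<^sub>R u) + t *\<^sub>R v) - ?Du (x + a *\<^sub>R u) =
      t * frechet_derivative ?Du (at ((x + a *\<^sub>R u) + b *\<^sub>R v)) v"
    by auto
  show ?thesis
  proof (rule that[of a b])
    have "f (x + t *\<^sub>R u + t *\<^sub>R v) - f (x + t *\<^sub>R u) - f (x + t *\<^sub>R v) + f x = g t - g 0"
      by (simp add: g_def algebra_simps)
    then show "f (x + t *\<^sub>R u + t *\<^sub>R v) - f (x + t *\<^sub>R u) - f (x + t *\<^sub>R v) + f x =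
       t * t * frechet_derivative ?Du (at (x + a *\<^sub>R u + b *\<^sub>R v)) v"
      using ga gb by (simp add: algebra_simps)
  qed (use a b in auto)
qed

text \<open>The second difference is symmetric in \<open>u\<close> and \<open>v\<close>, so the two
  mixed derivatives take equal values at two points of an arbitrarily small parallelogram;
  continuity brings both points to \<open>x\<close>.\<close>

lemma second_derivative_symmetric_real:
  fixes f :: "'a::real_normed_vector \<Rightarrow> real"
  assumes sm: "smooth_on S f" and S: "open S" "x \<in> S"
  shows "frechet_derivative (\<lambda>w. frechet_derivative f (at w) u) (at x) v =
    frechet_derivative (\<lambda>w. frechet_derivative f (at w) v) (at x) u"
proof -
  define D where "D = (\<lambda>u v y. frechet_derivative (\<lambda>w. frechet_derivative f (at w) u) (at y) v)"
  have "\<bar>D u v x - D v u x\<bar> \<le> e" if e: "0 < e" for e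
  proof -
    have "continuous_on S (D u v)" "continuous_on S (D v u)"
      unfolding D_def by (intro smooth_on_continuous smooth_on_frechet_derivative sm)+
    then have "\<exists>d>0. \<forall>y\<in>S. dist y x < d \<longrightarrow> dist (D u v y) (D u v x) < e / 2"
      "\<exists>d>0. \<forall>y\<in>S. dist y x < d \<longrightarrow> dist (D v u y) (D v u x) < e / 2"
      unfolding continuous_on_iff using S(2) half_gt_zero[OF e] by metis+
    then obtain d1 d2 where d: "0 < d1" "0 < d2"
      and d1: "\<And>y. y \<in> S \<Longrightarrow> dist y x < d1 \<Longrightarrow> dist (D u v y) (D u v x) < e / 2"
      and d2: "\<And>y. y \<in> S \<Longrightarrow> dist y x < d2 \<Longrightarrow> dist (D v u y) (D v u x) < e / 2"
      by blast
    obtain d0 where d0: "0 < d0" "ball x d0 \<subseteq> S"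
      using S open_contains_ball by blast
    define r where "r = Min {d0, d1, d2}"
    have r: "0 < r" "r \<le> d0" "r \<le> d1" "r \<le> d2"
      using d d0 by (auto simp: r_def)
    \<comment> \<open>The summand 1 keeps the denominator positive when \<open>u\<close> and
      \<open>v\<close> both vanish, and makes the bound on the distance strict.\<close>
    define t where "t = r / (norm u + norm v + 1)"
    have pos: "0 < norm u + norm v + 1"
      by (simp add: add_nonneg_pos)
    then have t: "0 < t" using r by (simp add: t_def)
    have near: "dist (x + a *\<^sub>R u + b *\<^sub>R v) x < r" if "0 \<le> a" "a \<le> t" "0 \<le> b" "b \<le> t" for a b
    proof -
      have "dist (x + a *\<^sub>R u + b *\<^sub>R v) x = norm (a *\<^sub>R u + b *\<^sub>R v)"
        by (simp add: dist_norm)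
      also have "\<dots> \<le> norm (a *\<^sub>R u) + norm (b *\<^sub>R v)"
        by (rule norm_triangle_ineq)
      also have "\<dots> \<le> t * norm u + t * norm v"
        using that by (auto intro!: add_mono mult_right_mono)
      also have "\<dots> < t * (norm u + norm v + 1)"
        using t by (simp add: algebra_simps)
      also have "\<dots> = r" using pos by (simp add: t_def)
      finally show ?thesis .
    qed
    have near': "dist (x + a *\<^sub>R v + b *\<^sub>R u) x < r" if "0 \<le> a" "a \<le> t" "0 \<le> b" "b \<le> t" for a b
      using near[OF that(3,4,1,2)] by (simp only: add.assoc add.commute[of "a *\<^sub>R v"])
    have inS: "y \<in> S" if "dist y x < r" for y
      using that r(2) d0(2) by (metis dist_commute less_le_trans mem_ball subsetD)
    obtain a b where ab: "0 \<le> a" "a \<le> t" "0 \<le> b" "b \<le> t"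
      and 1: "f (x + t *\<^sub>R u + t *\<^sub>R v) - f (x + t *\<^sub>R u) - f (x + t *\<^sub>R v) + f x =
        t * t * D u v (x + a *\<^sub>R u + b *\<^sub>R v)"
      unfolding D_def by (rule second_difference_mean_value[OF sm t inS[OF near]])
    obtain a' b' where ab': "0 \<le> a'" "a' \<le> t" "0 \<le> b'" "b' \<le> t"
      and 2: "f (x + t *\<^sub>R v + t *\<^sub>R u) - f (x + t *\<^sub>R v) - f (x + t *\<^sub>R u) + f x =
        t * t * D v u (x + a' *\<^sub>R v + b' *\<^sub>R u)"
      unfolding D_def by (rule second_difference_mean_value[OF sm t inS[OF near']])
    have "f (x + t *\<^sub>R v + t *\<^sub>R u) - f (x + t *\<^sub>R v) - f (x + t *\<^sub>R u) + f x =
        f (x + t *\<^sub>R u + t *\<^sub>R v) - f (x + t *\<^sub>R u) - f (x + t *\<^sub>R v) + f x"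
      by (simp only: add.assoc add.commute[of "t *\<^sub>R v" "t *\<^sub>R u"])
    then have "t * t * D u v (x + a *\<^sub>R u + b *\<^sub>R v) = t * t * D v u (x + a' *\<^sub>R v + b' *\<^sub>R u)"
      unfolding 1[symmetric] 2[symmetric] by (rule sym)
    moreover have "t * t \<noteq> 0" using t by simp
    ultimately have eq: "D u v (x + a *\<^sub>R u + b *\<^sub>R v) = D v u (x + a' *\<^sub>R v + b' *\<^sub>R u)"
      by (metis mult_left_cancel)
    have "dist (D u v (x + a *\<^sub>R u + b *\<^sub>R v)) (D u v x) < e / 2"
      by (rule d1[OF inS[OF near[OF ab]] less_le_trans[OF near[OF ab] r(3)]])
    moreover have "dist (D v u (x + a' *\<^sub>R v + b' *\<^sub>R u)) (D v u x) < e / 2"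
      by (rule d2[OF inS[OF near'[OF ab']] less_le_trans[OF near'[OF ab'] r(4)]])
    ultimately show ?thesis
      unfolding eq dist_real_def by linarith
  qed
  then have "\<bar>D u v x - D v u x\<bar> \<le> 0"
    using field_le_epsilon[of "\<bar>D u v x - D v u x\<bar>" 0] by simp
  then show ?thesis by (simp add: D_def)
qed

text \<open>The mean value theorem concerns real functions, so the values are tested against basis
  vectors; the inner product with a fixed vector commutes with differentiation.\<close>

lemma second_derivative_symmetric:
  fixes f :: "'a::real_normed_vector \<Rightarrow> 'b::euclidean_space"
  assumes sm: "smooth_on S f" and S: "open S" "x \<in> S"
  shows "frechet_derivative (\<lambda>w. frechet_derivative f (at w) u) (at x) v =
    frechet_derivative (\<lambda>w. frechet_derivative f (at w) v) (at x) u"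
proof (rule euclidean_eqI)
  fix b :: 'b assume "b \<in> Basis"
  have D: "frechet_derivative (\<lambda>y. g y \<bullet> b) (at y) v = frechet_derivative g (at y) v \<bullet> b"
    if "smooth_on S g" "y \<in> S" for g :: "'a \<Rightarrow> 'b" and y v
  proof -
    have "((\<lambda>y. g y \<bullet> b) has_derivative (\<lambda>v. frechet_derivative g (at y) v \<bullet> b)) (at y)"
      by (rule bounded_linear.has_derivative[OF bounded_linear_inner_left
          has_frechet_derivative[OF smooth_on_differentiable[OF that]]])
    then show ?thesis by (simp add: frechet_derivative_eq)
  qed
  have DD: "frechet_derivative (\<lambda>w. frechet_derivative f (at w) u) (at x) v \<bullet> b =
      frechet_derivative (\<lambda>w. frechet_derivative (\<lambda>y. f y \<bullet> b) (at w) u) (at x) v" for u v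
  proof -
    have sm': "smooth_on S (\<lambda>y. frechet_derivative f (at y) u)"
      by (rule smooth_on_frechet_derivative[OF sm])
    have "frechet_derivative (\<lambda>w. frechet_derivative f (at w) u \<bullet> b) (at x) =
        frechet_derivative (\<lambda>w. frechet_derivative (\<lambda>y. f y \<bullet> b) (at w) u) (at x)"
      using smooth_on_differentiable[OF sm' S(2)] D[OF sm] S
      by (intro frechet_derivative_transform_within_open[of _ _ S]) auto
    then show ?thesis
      using D[OF sm' S(2), of v] by simp
  qed
  have "smooth_on S (\<lambda>y. f y \<bullet> b)"
    by (rule smooth_on_bounded_linear[OF bounded_linear_inner_left S(1) sm])
  from second_derivative_symmetric_real[OF this S, of u v]
  show "frechet_derivative (\<lambda>w. frechet_derivative f (at w) u) (at x) v \<bullet> b =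
    frechet_derivative (\<lambda>w. frechet_derivative f (at w) v) (at x) u \<bullet> b"
    by (simp only: DD)
qed

section \<open>Wirtinger derivatives\<close>

text \<open>The index \<open>True\<close> stands for \<open>dz\<close>, \<open>\<partial>/\<partial>z\<close> and \<open>\<partial>\<close>, the index \<open>False\<close> for their conjugates.\<close>

definition covector :: "bool \<Rightarrow> 'n \<Rightarrow> complex^'n \<Rightarrow> complex" where
  "covector b i v = (if b then v $ i else cnj (v $ i))"

definition wirtinger ::
  "bool \<Rightarrow> 'n \<Rightarrow> (complex^'n::finite \<Rightarrow> complex) \<Rightarrow> complex^'n \<Rightarrow> complex" where
  "wirtinger b i f z = (if b then d_z i f z else d_zbar i f z)"

text \<open>The sign of \<i> in front of the derivative along y: -1 for \<partial>/\<partial>z, +1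
  for its conjugate.\<close>

definition cr_sign :: "bool \<Rightarrow> complex" where
  "cr_sign b = (if b then -1 else 1)"

text \<open>The complex linear (\<open>True\<close>) or antilinear (\<open>False\<close>) part of the real derivative.\<close>

definition type_derivative ::
  "bool \<Rightarrow> (complex^'n::finite \<Rightarrow> complex) \<Rightarrow> complex^'n \<Rightarrow> complex^'n \<Rightarrow> complex" where
  "type_derivative b f z v =
     (frechet_derivative f (at z) v + cr_sign b * \<i> * frechet_derivative f (at z) (\<i> *s v)) / 2"

lemma wirtinger_eq:
  "wirtinger b i f z = (frechet_derivative f (at z) (axis i 1) +
     cr_sign b * \<i> * frechet_derivative f (at z) (axis i \<i>)) / 2"
  by (simp add: wirtinger_def d_z_def d_zbar_def cr_sign_def)

text \<open>\<open>L\<close> is only real linear, hence both real directions of every complex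
  coordinate occur.\<close>

lemma linear_complex_vec_expand:
  fixes L :: "complex^'n::finite \<Rightarrow> complex"
  assumes "linear L"
  shows "L v = (\<Sum>i\<in>UNIV. of_real (Re (v $ i)) * L (axis i 1) + of_real (Im (v $ i)) * L (axis i \<i>))"
proof -
  have "v = (\<Sum>i\<in>UNIV. Re (v $ i) *\<^sub>R axis i 1 + Im (v $ i) *\<^sub>R axis i \<i>)"
    by (simp add: Finite_Cartesian_Product.vec_eq_iff axis_def complex_eq_iff if_distrib cong: if_cong)
  then have "L v = L (\<Sum>i\<in>UNIV. Re (v $ i) *\<^sub>R axis i 1 + Im (v $ i) *\<^sub>R axis i \<i>)"
    by (rule arg_cong)
  also have "\<dots> = (\<Sum>i\<in>UNIV. Re (v $ i) *\<^sub>R L (axis i 1) + Im (v $ i) *\<^sub>R L (axis i \<i>))"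
    using assms by (simp add: linear_sum linear_add linear_cmul)
  finally show ?thesis by (simp only: scaleR_conv_of_real)
qed

text \<open>Turns the coordinate sum in \<open>del\<close> and \<open>delbar\<close> into a
  projection of the real derivative. This does not refer to coordinates and can follow a change of
  chart.\<close>

lemma sum_covector_wirtinger:
  assumes "f differentiable (at z)"
  shows "(\<Sum>i\<in>UNIV. covector b i v * wirtinger b i f z) = type_derivative b f z v"
proof -
  let ?L = "frechet_derivative f (at z)"
  note expand = linear_complex_vec_expand[OF linear_frechet_derivative[OF assms]]
  have "type_derivative b f z v = (\<Sum>i\<in>UNIV.
      ((of_real (Re (v $ i)) * ?L (axis i 1) + of_real (Im (v $ i)) * ?L (axis i \<i>)) +
       cr_sign b * \<i> * (of_real (Re ((\<i> *s v) $ i)) * ?L (axis i 1) +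
         of_real (Im ((\<i> *s v) $ i)) * ?L (axis i \<i>))) / 2)"
    unfolding type_derivative_def expand[of v] expand[of "\<i> *s v"]
    by (simp only: sum.distrib sum_distrib_left sum_divide_distrib add_divide_distrib distrib_left)
  also have "\<dots> = (\<Sum>i\<in>UNIV. covector b i v * wirtinger b i f z)"
  proof (intro sum.cong refl)
    fix i :: 'a
    have "covector b i v = of_real (Re (v $ i)) - cr_sign b * \<i> * of_real (Im (v $ i))"
      by (simp add: covector_def cr_sign_def complex_eq_iff)
    moreover have "cr_sign b * cr_sign b = 1" "Re ((\<i> *s v) $ i) = - Im (v $ i)" "Im ((\<i> *s v) $ i) = Re (v $ i)"
      by (simp_all add: cr_sign_def)
    \<comment> \<open>The computation for one coordinate: \<open>s\<close> is
      \<open>cr_sign b\<close>, \<open>r\<close> and \<open>m\<close> are the real and imaginary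
      parts of the vector entry, \<open>x\<close> and \<open>y\<close> the two directional
      derivatives.\<close>
    moreover have "((r * x + m * y) + s * \<i> * (- m * x + r * y)) / 2 =
        (r - s * \<i> * m) * ((x + s * \<i> * y) / 2)" if "s * s = 1" for r m x y s :: complex
    proof -
      have "s * \<i> * m * (s * \<i> * y) = (s * s) * (\<i> * \<i>) * (m * y)"
        by (simp only: mult_ac)
      then have "s * \<i> * m * (s * \<i> * y) = - (m * y)"
        using that by simp
      then show ?thesis by (simp add: algebra_simps add_divide_distrib diff_divide_distrib)
    qed
    ultimately show "((of_real (Re (v $ i)) * ?L (axis i 1) + of_real (Im (v $ i)) * ?L (axis i \<i>)) +
       cr_sign b * \<i> * (of_real (Re ((\<i> *s v) $ i)) * ?L (axis i 1) +
         of_real (Im ((\<i> *s v) $ i)) * ?L (axis i \<i>))) / 2 = covector b i v * wirtinger b i f z"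
      by (simp only: wirtinger_eq of_real_minus)
  qed
  finally show ?thesis by simp
qed

lemma wirtinger_cong:
  assumes "open S" "z \<in> S" "f differentiable (at z)" "\<And>w. w \<in> S \<Longrightarrow> f w = g w"
  shows "wirtinger b i f z = wirtinger b i g z"
  unfolding wirtinger_eq using frechet_derivative_transform_within_open[OF assms(3,1,2,4)] by simp

lemma wirtinger_sum:
  assumes "\<And>k. k \<in> K \<Longrightarrow> f k differentiable (at z)"
  shows "wirtinger b i (\<lambda>w. \<Sum>k\<in>K. f k w * a k) z = (\<Sum>k\<in>K. wirtinger b i (f k) z * a k)"
proof -
  have "((\<lambda>w. \<Sum>k\<in>K. f k w * a k) has_derivative
      (\<lambda>v. \<Sum>k\<in>K. frechet_derivative (f k) (at z) v * a k)) (at z)"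
    by (intro has_derivative_sum has_derivative_mult_left has_frechet_derivative assms)
  from frechet_derivative_eq[OF this] show ?thesis
    by (simp only: wirtinger_eq sum.distrib sum_distrib_left sum_distrib_right sum_divide_distrib
        add_divide_distrib distrib_right distrib_left mult.assoc times_divide_eq_left)
qed

lemma smooth_on_wirtinger: "open S \<Longrightarrow> smooth_on S f \<Longrightarrow> smooth_on S (wirtinger b i f)"
proof -
  assume S: "open S" and f: "smooth_on S f"
  have "smooth_on S (\<lambda>z. (1 / 2) * (frechet_derivative f (at z) (axis i 1) +
      (cr_sign b * \<i>) * frechet_derivative f (at z) (axis i \<i>)))"
    using S f by (intro smooth_on_cmult smooth_on_add smooth_on_frechet_derivative)
  then show ?thesis
    by (simp add: wirtinger_eq[abs_def])
qed

text \<open>Both sides expand into the same four real second derivatives, up to the order of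
  differentiation.\<close>

lemma wirtinger_commute:
  assumes S: "open S" "z \<in> S" and f: "smooth_on S f"
  shows "wirtinger b i (wirtinger b' j f) z = wirtinger b' j (wirtinger b i f) z"
proof -
  let ?D = "\<lambda>u v. frechet_derivative (\<lambda>w. frechet_derivative f (at w) u) (at z) v"
  have D: "frechet_derivative (wirtinger b' j f) (at z) v =
      (?D (axis j 1) v + cr_sign b' * \<i> * ?D (axis j \<i>) v) / 2" for b' j v
  proof -
    have "(wirtinger b' j f has_derivative
        (\<lambda>v. (?D (axis j 1) v + cr_sign b' * \<i> * ?D (axis j \<i>) v) / 2)) (at z)"
      unfolding wirtinger_eq[abs_def]
      by (intro bounded_linear.has_derivative[OF bounded_linear_divide] has_derivative_add has_derivative_mult_right has_frechet_derivative
          smooth_on_differentiable[OF smooth_on_frechet_derivative[OF f] S(2)])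
    from frechet_derivative_eq[OF this] show ?thesis by simp
  qed
  have sym: "?D u v = ?D v u" for u v
    by (rule second_derivative_symmetric[OF f S])
  show ?thesis
    unfolding wirtinger_eq[of b i "wirtinger b' j f"] wirtinger_eq[of b' j "wirtinger b i f"] D
    using sym[of "axis j 1" "axis i 1"] sym[of "axis j 1" "axis i \<i>"]
      sym[of "axis j \<i>" "axis i 1"] sym[of "axis j \<i>" "axis i \<i>"]
    by (simp add: algebra_simps add_divide_distrib)
qed

section \<open>The Dolbeault operators in a chart\<close>

text \<open>The formula common to \<open>del\<close> and \<open>delbar\<close> inside a single
  chart, without the cut-off outside its image; the boolean allows one proof for both
  operators.\<close>

definition local_dolbeault :: "bool \<Rightarrow> (complex^'n::finite \<Rightarrow> (complex^'n) list \<Rightarrow> complex) \<Rightarrow>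
    complex^'n \<Rightarrow> (complex^'n) list \<Rightarrow> complex" where
  "local_dolbeault b \<eta> z vs = (\<Sum>j<length vs. (-1) ^ j *
     (\<Sum>i\<in>UNIV. covector b i (vs ! j) * wirtinger b i (\<lambda>w. \<eta> w (omit j vs)) z))"

definition dolbeault :: "bool \<Rightarrow> ('a, 'n::finite) form \<Rightarrow> ('a, 'n) form" where
  "dolbeault b \<omega> = (if b then del \<omega> else delbar \<omega>)"

lemma dolbeault_eq:
  "dolbeault b \<omega> c z vs = (if z \<in> snd c ` fst c then local_dolbeault b (\<omega> c) z vs else 0)"
  by (simp add: dolbeault_def local_dolbeault_def del_def delbar_def covector_def wirtinger_def)

lemma local_dolbeault_type_derivative:
  assumes "\<And>us. (\<lambda>w. \<eta> w us) differentiable (at z)"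
  shows "local_dolbeault b \<eta> z vs =
    (\<Sum>j<length vs. (-1) ^ j * type_derivative b (\<lambda>w. \<eta> w (omit j vs)) z (vs ! j))"
  unfolding local_dolbeault_def by (simp only: sum_covector_wirtinger[OF assms])

text \<open>Index set and covectors are arbitrary, and neither a bidegree nor uniqueness of
  coefficients is asked for. The class is therefore closed under the operators at once: each
  prepends a covector and enlarges the index set.\<close>

definition wedge_expansion :: "(complex^'n::finite) set \<Rightarrow> 'k set \<Rightarrow> ('k \<Rightarrow> complex^'n \<Rightarrow> complex) \<Rightarrow>
    ('k \<Rightarrow> (complex^'n \<Rightarrow> complex) list) \<Rightarrow> (complex^'n \<Rightarrow> (complex^'n) list \<Rightarrow> complex) \<Rightarrow> bool" where
  "wedge_expansion S K f \<alpha> \<eta> \<longleftrightarrow> finite K \<and> (\<forall>k\<in>K. smooth_on S (f k)) \<and>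
     (\<forall>z\<in>S. \<forall>vs. \<eta> z vs = (\<Sum>k\<in>K. f k z * wedge (\<alpha> k) vs))"

lemma wedge_expansion_has_derivative:
  assumes \<eta>: "wedge_expansion S K f \<alpha> \<eta>" and S: "open S" "z \<in> S"
  shows "((\<lambda>w. \<eta> w us) has_derivative
    (\<lambda>v. \<Sum>k\<in>K. frechet_derivative (f k) (at z) v * wedge (\<alpha> k) us)) (at z)"
proof -
  have "((\<lambda>w. \<Sum>k\<in>K. f k w * wedge (\<alpha> k) us) has_derivative
      (\<lambda>v. \<Sum>k\<in>K. frechet_derivative (f k) (at z) v * wedge (\<alpha> k) us)) (at z)"
    using \<eta> S(2) unfolding wedge_expansion_def
    by (intro has_derivative_sum has_derivative_mult_left has_frechet_derivative) 
      (blast intro: smooth_on_differentiable)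
  then show ?thesis
    using \<eta> by (rule_tac has_derivative_transform_within_open[OF _ S]) (auto simp: wedge_expansion_def)
qed

lemma wedge_expansion_differentiable:
  "wedge_expansion S K f \<alpha> \<eta> \<Longrightarrow> open S \<Longrightarrow> z \<in> S \<Longrightarrow> (\<lambda>w. \<eta> w us) differentiable (at z)"
  using wedge_expansion_has_derivative unfolding differentiable_def by blast

lemma wedge_expansion_local_dolbeault:
  assumes \<eta>: "wedge_expansion S K f \<alpha> \<eta>" and S: "open S"
    and \<theta>: "\<And>z vs. z \<in> S \<Longrightarrow> \<theta> z vs = local_dolbeault b \<eta> z vs"
  shows "wedge_expansion S (UNIV \<times> K) (\<lambda>(i, k). wirtinger b i (f k)) (\<lambda>(i, k). covector b i # \<alpha> k) \<theta>"
proof -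
  have fin: "finite K" and f: "\<And>k. k \<in> K \<Longrightarrow> smooth_on S (f k)"
    and eq: "\<And>z vs. z \<in> S \<Longrightarrow> \<eta> z vs = (\<Sum>k\<in>K. f k z * wedge (\<alpha> k) vs)"
    using \<eta> by (auto simp: wedge_expansion_def)
  have "\<theta> z vs = (\<Sum>(i, k)\<in>UNIV \<times> K. wirtinger b i (f k) z * wedge (covector b i # \<alpha> k) vs)"
    if z: "z \<in> S" for z vs
  proof -
    have "wirtinger b i (\<lambda>w. \<eta> w us) z = (\<Sum>k\<in>K. wirtinger b i (f k) z * wedge (\<alpha> k) us)" for i us
    proof -
      have "wirtinger b i (\<lambda>w. \<eta> w us) z = wirtinger b i (\<lambda>w. \<Sum>k\<in>K. f k w * wedge (\<alpha> k) us) z"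
        by (rule wirtinger_cong[OF S z wedge_expansion_differentiable[OF \<eta> S z] eq])
      also have "\<dots> = (\<Sum>k\<in>K. wirtinger b i (f k) z * wedge (\<alpha> k) us)"
        by (rule wirtinger_sum[OF smooth_on_differentiable[OF f z]])
      finally show ?thesis .
    qed
    then have "\<theta> z vs = (\<Sum>j<length vs. (-1) ^ j * (\<Sum>i\<in>UNIV. covector b i (vs ! j) *
        (\<Sum>k\<in>K. wirtinger b i (f k) z * wedge (\<alpha> k) (omit j vs))))"
      by (simp only: \<theta>[OF z] local_dolbeault_def)
    also have "\<dots> = (\<Sum>j<length vs. \<Sum>(i, k)\<in>UNIV \<times> K. wirtinger b i (f k) z *
        ((-1) ^ j * (covector b i (vs ! j) * wedge (\<alpha> k) (omit j vs))))"
      by (simp only: sum_distrib_left sum.cartesian_product mult.assoc mult.left_commute case_prod_unfold)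
    \<comment> \<open>Once the sum over \<open>j\<close> is innermost, it is the expansion in
      \<open>wedge_Cons\<close> of a wedge with one more covector.\<close>
    also have "\<dots> = (\<Sum>(i, k)\<in>UNIV \<times> K. wirtinger b i (f k) z * wedge (covector b i # \<alpha> k) vs)"
      by (subst sum.swap) (simp only: wedge_Cons sum_distrib_left case_prod_unfold)
    finally show ?thesis .
  qed
  then show ?thesis
    using fin f S by (auto simp: wedge_expansion_def case_prod_unfold intro: smooth_on_wirtinger)
qed

text \<open>The case \<open>b = b'\<close> is included and will give that each operator squares to
  zero. \<open>\<theta>\<close> and \<open>\<theta>'\<close> need to agree with the formula only on
  \<open>S\<close>, because \<open>dolbeault\<close> is cut off outside the chart image.\<close>

lemma local_dolbeault_anticommute:
  assumes \<eta>: "wedge_expansion S K f \<alpha> \<eta>" and S: "open S" "z \<in> S"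
    and \<theta>: "\<And>z vs. z \<in> S \<Longrightarrow> \<theta> z vs = local_dolbeault b \<eta> z vs"
    and \<theta>': "\<And>z vs. z \<in> S \<Longrightarrow> \<theta>' z vs = local_dolbeault b' \<eta> z vs"
  shows "local_dolbeault b' \<theta> z vs = - local_dolbeault b \<theta>' z vs"
proof -
  have f: "\<And>k. k \<in> K \<Longrightarrow> smooth_on S (f k)"
    using \<eta> by (auto simp: wedge_expansion_def)
  have swap: "wedge (covector b' i # covector b j # \<gamma>s) vs = - wedge (covector b j # covector b' i # \<gamma>s) vs"
    for i j \<gamma>s
    using wedge_swap[of "[]"] by simp
  have "local_dolbeault b' \<theta> z vs = (\<Sum>(i, j, k)\<in>UNIV \<times> UNIV \<times> K.
      wirtinger b' i (wirtinger b j (f k)) z * wedge (covector b' i # covector b j # \<alpha> k) vs)"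
    using wedge_expansion_local_dolbeault[OF wedge_expansion_local_dolbeault[OF \<eta> S(1) \<theta>] S(1) refl, of b'] S(2)
    by (simp add: wedge_expansion_def case_prod_unfold)
  also have "\<dots> = (\<Sum>(j, i, k)\<in>UNIV \<times> UNIV \<times> K.
      - (wirtinger b j (wirtinger b' i (f k)) z * wedge (covector b j # covector b' i # \<alpha> k) vs))"
    by (intro sum.reindex_bij_witness[of _ "\<lambda>(j, i, k). (i, j, k)" "\<lambda>(i, j, k). (j, i, k)"])
      (auto simp: wirtinger_commute[OF S f] swap)
  also have "\<dots> = - local_dolbeault b \<theta>' z vs"
    using wedge_expansion_local_dolbeault[OF wedge_expansion_local_dolbeault[OF \<eta> S(1) \<theta>'] S(1) refl, of b] S(2)
    by (simp add: wedge_expansion_def case_prod_unfold sum_negf)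
  finally show ?thesis .
qed

section \<open>The bidegree of the image under each operator\<close>

definition coframe :: "'n list \<Rightarrow> 'n list \<Rightarrow> (complex^'n \<Rightarrow> complex) list" where
  "coframe I J = map (covector True) I @ map (covector False) J"

lemma dz_dzbar_eq: "dz_dzbar I J = wedge (coframe I J)"
  by (simp add: dz_dzbar_def coframe_def covector_def[abs_def])

lemma finite_multi_indices: "finite {I :: 'n::finite list. length I = p}"
  using finite_lists_length_eq[of "UNIV :: 'n set" p] by simp

lemma local_form_iff:
  fixes \<eta> :: "complex^'n::finite \<Rightarrow> (complex^'n) list \<Rightarrow> complex"
  shows "local_form p q S \<eta> \<longleftrightarrow>
    (\<exists>f. wedge_expansion S ({I. length I = p} \<times> {J. length J = q}) f (\<lambda>(I, J). coframe I J) \<eta>) \<and>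
    (\<forall>z vs. z \<notin> S \<longrightarrow> \<eta> z vs = 0)" (is "?L \<longleftrightarrow> ?R")
proof
  assume ?L
  then obtain f where f: "\<And>I J. length I = p \<Longrightarrow> length J = q \<Longrightarrow> smooth_on S (f I J)"
    and eq: "\<And>z vs. z \<in> S \<Longrightarrow> \<eta> z vs =
      (\<Sum>I | length I = p. \<Sum>J | length J = q. f I J z * dz_dzbar I J vs)"
    and 0: "\<And>z vs. z \<notin> S \<Longrightarrow> \<eta> z vs = 0"
    unfolding local_form_def by blast
  have "wedge_expansion S ({I. length I = p} \<times> {J. length J = q}) (\<lambda>(I, J). f I J) (\<lambda>(I, J). coframe I J) \<eta>"
    using f eq finite_cartesian_product[OF finite_multi_indices finite_multi_indices]
    by (auto simp: wedge_expansion_def sum.cartesian_product case_prod_unfold dz_dzbar_eq)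
  with 0 show ?R by blast
next
  assume ?R
  then obtain f where f: "wedge_expansion S ({I. length I = p} \<times> {J. length J = q}) f (\<lambda>(I, J). coframe I J) \<eta>"
    and 0: "\<And>z vs. z \<notin> S \<Longrightarrow> \<eta> z vs = 0"
    by blast
  then have "\<forall>z\<in>S. \<forall>vs. \<eta> z vs =
      (\<Sum>I | length I = p. \<Sum>J | length J = q. f (I, J) z * dz_dzbar I J vs)"
    by (simp add: wedge_expansion_def sum.cartesian_product case_prod_unfold dz_dzbar_eq)
  moreover have "\<forall>I J. length I = p \<longrightarrow> length J = q \<longrightarrow> smooth_on S (f (I, J))"
    using f by (auto simp: wedge_expansion_def)
  ultimately show ?L
    unfolding local_form_def using 0 by (intro conjI exI[of _ "\<lambda>I J. f (I, J)"]) auto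
qed

lemma local_form_del:
  assumes \<eta>: "local_form p q S \<eta>" and S: "open S"
    and \<theta>: "\<And>z vs. z \<in> S \<Longrightarrow> \<theta> z vs = local_dolbeault True \<eta> z vs"
    and \<theta>0: "\<And>z vs. z \<notin> S \<Longrightarrow> \<theta> z vs = 0"
  shows "local_form (Suc p) q S \<theta>"
proof -
  let ?K = "{I. length I = p} \<times> {J. length J = q}"
  let ?K' = "{I. length I = Suc p} \<times> {J. length J = q}"
  obtain f where f: "wedge_expansion S ?K f (\<lambda>(I, J). coframe I J) \<eta>"
    using \<eta> by (auto simp: local_form_iff)
  \<comment> \<open>A covector put in front of \<open>coframe I J\<close> gives
    \<open>coframe (i # I) J\<close>, so the head of the longer multi-index is the variable of
    differentiation.\<close>
  let ?g = "\<lambda>(I, J). wirtinger True (hd I) (f (tl I, J))"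
  note exp = wedge_expansion_local_dolbeault[OF f S \<theta>]
  have "\<theta> z vs = (\<Sum>k\<in>?K'. ?g k z * wedge (case k of (I, J) \<Rightarrow> coframe I J) vs)" if "z \<in> S" for z vs
  proof -
    have "\<theta> z vs = (\<Sum>(i, I, J)\<in>UNIV \<times> ?K. wirtinger True i (f (I, J)) z * wedge (coframe (i # I) J) vs)"
      using exp that by (simp add: wedge_expansion_def case_prod_unfold coframe_def)
    also have "\<dots> = (\<Sum>k\<in>?K'. ?g k z * wedge (case k of (I, J) \<Rightarrow> coframe I J) vs)"
      by (intro sum.reindex_bij_witness[of _ "\<lambda>(I, J). (hd I, tl I, J)" "\<lambda>(i, I, J). (i # I, J)"])
        (auto simp: length_Suc_conv)
    finally show ?thesis .
  qed
  moreover have "smooth_on S (?g k)" if "k \<in> ?K'" for k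
  proof -
    obtain I J where k: "k = (I, J)" "length I = Suc p" "length J = q" using \<open>k \<in> ?K'\<close> by auto
    then have "smooth_on S (f (tl I, J))"
      using f by (auto simp: wedge_expansion_def)
    then show ?thesis
      using smooth_on_wirtinger[OF S] k(1) by simp
  qed
  ultimately have "wedge_expansion S ?K' ?g (\<lambda>(I, J). coframe I J) \<theta>"
    unfolding wedge_expansion_def
    using finite_cartesian_product[OF finite_multi_indices finite_multi_indices] by blast
  with \<theta>0 show ?thesis unfolding local_form_iff by blast
qed

lemma local_form_delbar:
  assumes \<eta>: "local_form p q S \<eta>" and S: "open S"
    and \<theta>: "\<And>z vs. z \<in> S \<Longrightarrow> \<theta> z vs = local_dolbeault False \<eta> z vs"
    and \<theta>0: "\<And>z vs. z \<notin> S \<Longrightarrow> \<theta> z vs = 0"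
  shows "local_form p (Suc q) S \<theta>"
proof -
  let ?K = "{I. length I = p} \<times> {J. length J = q}"
  let ?K' = "{I. length I = p} \<times> {J. length J = Suc q}"
  obtain f where f: "wedge_expansion S ?K f (\<lambda>(I, J). coframe I J) \<eta>"
    using \<eta> by (auto simp: local_form_iff)
  \<comment> \<open>The new covector stands in front of the \<open>p\<close> holomorphic ones and
    has to pass all of them to reach its place, whence the sign.\<close>
  let ?g = "\<lambda>(I, J) z. (-1) ^ p * wirtinger False (hd J) (f (I, tl J)) z"
  note exp = wedge_expansion_local_dolbeault[OF f S \<theta>]
  have mv: "wedge (covector False j # coframe I J) vs = (-1) ^ p * wedge (coframe I (j # J)) vs"
    if "length I = p" for j I J vs
    using wedge_move[of "[]" "covector False j" "map (covector True) I" "map (covector False) J" vs] that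
    by (simp add: coframe_def)
  have "\<theta> z vs = (\<Sum>k\<in>?K'. ?g k z * wedge (case k of (I, J) \<Rightarrow> coframe I J) vs)" if "z \<in> S" for z vs
  proof -
    have "\<theta> z vs = (\<Sum>(j, I, J)\<in>UNIV \<times> ?K. wirtinger False j (f (I, J)) z * wedge (covector False j # coframe I J) vs)"
      using exp that by (simp add: wedge_expansion_def case_prod_unfold)
    also have "\<dots> = (\<Sum>k\<in>?K'. ?g k z * wedge (case k of (I, J) \<Rightarrow> coframe I J) vs)"
      by (intro sum.reindex_bij_witness[of _ "\<lambda>(I, J). (hd J, I, tl J)" "\<lambda>(j, I, J). (I, j # J)"])
        (auto simp: length_Suc_conv mv)
    finally show ?thesis .
  qed
  moreover have "smooth_on S (?g k)" if "k \<in> ?K'" for k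
  proof -
    obtain I J where k: "k = (I, J)" "length I = p" "length J = Suc q" using \<open>k \<in> ?K'\<close> by auto
    then have "smooth_on S (f (I, tl J))"
      using f by (auto simp: wedge_expansion_def)
    then show ?thesis
      using smooth_on_cmult[OF S smooth_on_wirtinger[OF S]] k(1) by simp
  qed
  ultimately have "wedge_expansion S ?K' ?g (\<lambda>(I, J). coframe I J) \<theta>"
    unfolding wedge_expansion_def
    using finite_cartesian_product[OF finite_multi_indices finite_multi_indices] by blast
  with \<theta>0 show ?thesis unfolding local_form_iff by blast
qed

section \<open>Invariance under holomorphic maps\<close>

text \<open>The product rule: each summand differentiates one slot. In the application
  \<open>A\<close> is the Jacobian of a coordinate change and \<open>B\<close> its second
  derivative, and the sum is the second-order part of a pulled-back form.\<close>

lemma wedge_has_derivative: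
  assumes \<alpha>s: "\<And>\<alpha>. \<alpha> \<in> set \<alpha>s \<Longrightarrow> bounded_linear \<alpha>"
    and A: "\<And>u. u \<in> set us \<Longrightarrow> ((\<lambda>w. A w u) has_derivative (\<lambda>v. B v u)) (at z)"
  shows "((\<lambda>w. wedge \<alpha>s (map (A w) us)) has_derivative
    (\<lambda>v. \<Sum>m<length us. wedge \<alpha>s ((map (A z) us)[m := B v (us ! m)]))) (at z)"
proof (cases "length us = length \<alpha>s")
  case False
  then show ?thesis by (simp add: wedge_def)
next
  case True
  let ?n = "length \<alpha>s"
  let ?P = "{\<sigma>. \<sigma> permutes {..<?n}}"
  let ?us = "\<lambda>v m. (map (A z) us)[m := B v (us ! m)]"
  have lt: "\<sigma> i < ?n" if "\<sigma> \<in> ?P" "i < ?n" for \<sigma> i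
    using permutes_in_image[of \<sigma> "{..<?n}" i] that by simp
  have "((\<lambda>w. \<Sum>\<sigma>\<in>?P. of_int (sign \<sigma>) * (\<Prod>i<?n. (\<alpha>s ! i) (A w (us ! \<sigma> i)))) has_derivative
      (\<lambda>v. \<Sum>\<sigma>\<in>?P. of_int (sign \<sigma>) * (\<Sum>i<?n. (\<alpha>s ! i) (B v (us ! \<sigma> i)) *
        (\<Prod>j\<in>{..<?n} - {i}. (\<alpha>s ! j) (A z (us ! \<sigma> j)))))) (at z)"
    using True lt
    by (intro has_derivative_sum has_derivative_mult_right has_derivative_prod
        bounded_linear.has_derivative[OF \<alpha>s] A) auto
  moreover have "(\<Sum>\<sigma>\<in>?P. of_int (sign \<sigma>) * (\<Prod>i<?n. (\<alpha>s ! i) (A w (us ! \<sigma> i)))) =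
      wedge \<alpha>s (map (A w) us)" for w
    using True lt by (simp add: wedge_def)
  moreover have "(\<Sum>\<sigma>\<in>?P. of_int (sign \<sigma>) * (\<Sum>i<?n. (\<alpha>s ! i) (B v (us ! \<sigma> i)) *
        (\<Prod>j\<in>{..<?n} - {i}. (\<alpha>s ! j) (A z (us ! \<sigma> j))))) =
      (\<Sum>m<length us. wedge \<alpha>s (?us v m))" for v
  proof -
    have "(\<Sum>i<?n. (\<alpha>s ! i) (B v (us ! \<sigma> i)) * (\<Prod>j\<in>{..<?n} - {i}. (\<alpha>s ! j) (A z (us ! \<sigma> j)))) =
        (\<Sum>m<?n. \<Prod>j<?n. (\<alpha>s ! j) (?us v m ! \<sigma> j))" if \<sigma>: "\<sigma> \<in> ?P" for \<sigma>
    proof -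
      have perm: "\<sigma> permutes {..<?n}" using \<sigma> by simp
      \<comment> \<open>For a fixed permutation the changed slot is written as
        \<open>\<sigma> i\<close>, where \<open>i\<close> is the covector evaluated there.\<close>
      have "(\<Sum>m<?n. \<Prod>j<?n. (\<alpha>s ! j) (?us v m ! \<sigma> j)) =
          (\<Sum>i<?n. \<Prod>j<?n. (\<alpha>s ! j) (?us v (\<sigma> i) ! \<sigma> j))"
        by (rule sum.reindex_bij_betw[OF permutes_imp_bij[OF perm], symmetric])
      also have "\<dots> = (\<Sum>i<?n. (\<alpha>s ! i) (B v (us ! \<sigma> i)) *
          (\<Prod>j\<in>{..<?n} - {i}. (\<alpha>s ! j) (A z (us ! \<sigma> j))))"
      proof (intro sum.cong refl)
        fix i assume i: "i \<in> {..<?n}"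
        have "(\<Prod>j<?n. (\<alpha>s ! j) (?us v (\<sigma> i) ! \<sigma> j)) = (\<alpha>s ! i) (?us v (\<sigma> i) ! \<sigma> i) *
            (\<Prod>j\<in>{..<?n} - {i}. (\<alpha>s ! j) (?us v (\<sigma> i) ! \<sigma> j))"
          using i by (intro prod.remove) auto
        also have "?us v (\<sigma> i) ! \<sigma> i = B v (us ! \<sigma> i)"
          using lt[OF \<sigma>] i True by simp
        also have "(\<Prod>j\<in>{..<?n} - {i}. (\<alpha>s ! j) (?us v (\<sigma> i) ! \<sigma> j)) =
            (\<Prod>j\<in>{..<?n} - {i}. (\<alpha>s ! j) (A z (us ! \<sigma> j)))"
        proof (intro prod.cong refl)
          fix j assume j: "j \<in> {..<?n} - {i}"
          then have "\<sigma> i \<noteq> \<sigma> j"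
            using permutes_inj[OF perm] by (auto dest: injD)
          then show "(\<alpha>s ! j) (?us v (\<sigma> i) ! \<sigma> j) = (\<alpha>s ! j) (A z (us ! \<sigma> j))"
            using j lt[OF \<sigma>, of j] True by simp
        qed
        finally show "(\<Prod>j<?n. (\<alpha>s ! j) (?us v (\<sigma> i) ! \<sigma> j)) = (\<alpha>s ! i) (B v (us ! \<sigma> i)) *
            (\<Prod>j\<in>{..<?n} - {i}. (\<alpha>s ! j) (A z (us ! \<sigma> j)))" .
      qed
      finally show ?thesis by simp
    qed
    then have "(\<Sum>\<sigma>\<in>?P. of_int (sign \<sigma>) * (\<Sum>i<?n. (\<alpha>s ! i) (B v (us ! \<sigma> i)) *
        (\<Prod>j\<in>{..<?n} - {i}. (\<alpha>s ! j) (A z (us ! \<sigma> j))))) =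
        (\<Sum>\<sigma>\<in>?P. \<Sum>m<?n. of_int (sign \<sigma>) * (\<Prod>j<?n. (\<alpha>s ! j) (?us v m ! \<sigma> j)))"
      by (intro sum.cong refl) (simp only: sum_distrib_left)
    also have "\<dots> = (\<Sum>m<?n. wedge \<alpha>s (?us v m))"
      using True by (subst sum.swap) (simp add: wedge_def)
    finally show ?thesis using True by simp
  qed
  ultimately show ?thesis by simp
qed

text \<open>The terms in which \<open>B\<close> is applied to the \<open>j\<close>-th and \<open>k\<close>-th vector and put in the place of one of
  them, the other one being omitted, cancel in pairs. The map \<open>swap\<close> exchanges the two roles.\<close>

lemma wedge_symmetric_insert_cancel:
  assumes B: "\<And>u v. B u v = B v u"
  shows "(\<Sum>j<length vs. (-1) ^ j * (\<Sum>m<length vs - 1.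
    wedge \<alpha>s ((map A (omit j vs))[m := B (vs ! j) (omit j vs ! m)]))) = 0"
proof -
  let ?n = "length vs"
  let ?P = "{..<?n} \<times> {..<?n - 1}"
  define t where "t = (\<lambda>(j, m). (-1) ^ j *
    wedge \<alpha>s ((map A (omit j vs))[m := B (vs ! j) (omit j vs ! m)]))"
  \<comment> \<open>In \<open>(j, m)\<close>, \<open>j\<close> is the position of the omitted vector
    and \<open>m\<close> the position in the shortened list of the replaced one. Omission lowers all
    later positions by one, hence \<open>j - 1\<close> and \<open>Suc m\<close>.\<close>
  define swap where "swap = (\<lambda>(j::nat, m::nat). if m < j then (m, j - 1) else (Suc m, j))"
  have neg: "t (j, k) = - t (k, j - 1)" if "k < j" "j < ?n" for j k
  proof -
    \<comment> \<open>\<open>d\<close> vectors lie between the two. Moving the inserted value across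
      them gives \<open>(-1) ^ d\<close>, and with \<open>j = k + d + 1\<close> the two terms get
      opposite signs.\<close>
    obtain d where d: "j = Suc (k + d)" using less_imp_Suc_add[OF \<open>k < j\<close>] by blast
    define us x ys y ws where "us = take k vs" and "x = vs ! k"
      and "ys = take d (drop (Suc k) vs)" and "y = vs ! j" and "ws = drop (Suc j) vs"
    have "drop k vs = x # drop (Suc k) vs"
      using that unfolding x_def by (intro Cons_nth_drop_Suc[symmetric]) simp
    also have "drop (Suc k) vs = ys @ drop d (drop (Suc k) vs)"
      unfolding ys_def by (rule append_take_drop_id[symmetric])
    also have "drop d (drop (Suc k) vs) = drop j vs"
      by (simp add: d add.commute)
    also have "drop j vs = y # ws"
      using that unfolding y_def ws_def by (intro Cons_nth_drop_Suc[symmetric]) simp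
    finally have vs: "vs = us @ [x] @ ys @ [y] @ ws"
      using append_take_drop_id[of k vs] by (simp add: us_def)
    have len: "length us = k" "length ys = d"
      using that by (auto simp: us_def ys_def d)
    have "omit k vs = us @ ys @ [y] @ ws"
      using len by (subst vs) (simp add: omit_def)
    moreover have "omit j vs = us @ [x] @ ys @ ws"
      using len by (subst vs) (simp add: omit_def d)
    ultimately have
      k: "(map A (omit k vs))[j - 1 := B (vs ! k) (omit k vs ! (j - 1))] =
        map A us @ map A ys @ [B y x] @ map A ws" and
      j: "(map A (omit j vs))[k := B (vs ! j) (omit j vs ! k)] =
        map A us @ [B y x] @ map A ys @ map A ws"
      unfolding x_def[symmetric] y_def[symmetric] B[of x y]
      using len by (simp_all add: d list_update_append nth_append B[of x y])
    show ?thesis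
      unfolding t_def prod.case j k wedge_move_vector[of \<alpha>s "map A us" "B y x" "map A ys" "map A ws"]
      by (simp add: len d power_add)
  qed
  have flip: "t x = - t (swap x)" if "x \<in> ?P" for x
  proof -
    obtain j m where x: "x = (j, m)" "j < ?n" "m < ?n - 1" using \<open>x \<in> ?P\<close> by auto
    show ?thesis
    proof (cases "m < j")
      case True
      then show ?thesis using neg[OF True x(2)] by (simp only: x swap_def prod.case if_True)
    next
      case False
      then have "t (Suc m, j) = - t (j, m)" using neg[of j "Suc m"] x(3) by simp
      then show ?thesis using False by (simp add: x swap_def)
    qed
  qed
  have inv: "swap (swap x) = x" "swap x \<in> ?P" if "x \<in> ?P" for x
    using that by (cases x; force simp: swap_def)+
  have "(\<Sum>x\<in>?P. t x) = (\<Sum>x\<in>?P. - t x)"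
  proof (rule sum.reindex_bij_witness[of _ swap swap])
    show "- t (swap x) = t x" if "x \<in> ?P" for x
      using flip[OF that] by simp
  qed (use inv in blast)+
  then have "(\<Sum>x\<in>?P. t x) = 0"
    by (simp add: sum_negf)
  then show ?thesis
    by (simp only: sum_distrib_left sum.cartesian_product t_def)
qed

lemma bounded_linear_i_scale: "bounded_linear (\<lambda>v :: complex^'n::finite. \<i> *s v)"
  by (intro linear_conv_bounded_linear[THEN iffD1] linearI)
    (simp_all add: Finite_Cartesian_Product.vec_eq_iff algebra_simps)

lemma frechet_derivative_vec_nth:
  fixes T :: "complex^'n::finite \<Rightarrow> complex^'m::finite"
  assumes "T differentiable (at z)"
  shows "((\<lambda>w. T w $ j) has_derivative (\<lambda>v. frechet_derivative T (at z) v $ j)) (at z)"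
  by (rule bounded_linear.has_derivative[OF bounded_linear_vec_nth has_frechet_derivative[OF assms]])

text \<open>The Cauchy-Riemann equations say that the antilinear part of the derivative,
  \<open>type_derivative False\<close>, vanishes in every component.\<close>

lemma holomorphic_derivative_i_scale:
  fixes T :: "complex^'n::finite \<Rightarrow> complex^'m::finite"
  assumes T: "holomorphic_map_on S T" and z: "z \<in> S"
  shows "frechet_derivative T (at z) (\<i> *s v) = \<i> *s frechet_derivative T (at z) v"
proof -
  have "frechet_derivative T (at z) (\<i> *s v) $ j = \<i> * frechet_derivative T (at z) v $ j" for j
  proof -
    have diff: "T differentiable (at z)"
      using T z by (auto simp: holomorphic_map_on_def intro: smooth_on_differentiable)
    note D = frechet_derivative_vec_nth[OF diff, of j]
    have "wirtinger False i (\<lambda>w. T w $ j) z = 0" for i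
      using T z by (simp add: holomorphic_map_on_def wirtinger_def)
    then have "type_derivative False (\<lambda>w. T w $ j) z v = 0"
      using sum_covector_wirtinger[OF differentiableI[OF D], of False v] by simp
    then have "frechet_derivative T (at z) v $ j + \<i> * frechet_derivative T (at z) (\<i> *s v) $ j = 0"
      by (simp add: type_derivative_def frechet_derivative_eq[OF D] cr_sign_def)
    then have "\<i> * (frechet_derivative T (at z) v $ j + \<i> * frechet_derivative T (at z) (\<i> *s v) $ j) = 0"
      by (simp only: mult_zero_right)
    then show ?thesis by (simp add: algebra_simps)
  qed
  then show ?thesis by (simp add: Finite_Cartesian_Product.vec_eq_iff)
qed

lemma omit_map: "map g (omit j vs) = omit j (map g vs)"
  by (simp add: omit_def take_map drop_map)

text \<open>By the chain rule the derivative of \<open>\<eta>\<close> is the transported derivative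
  of \<open>\<xi>\<close> plus the terms \<open>R\<close> with second derivatives of
  \<open>T\<close>. Complex linearity of the first derivative of \<open>T\<close> makes the former
  respect types; the latter cancel in the alternating sum.\<close>

lemma local_dolbeault_pullback:
  fixes T :: "complex^'n::finite \<Rightarrow> complex^'m::finite"
  assumes U: "open U" "z \<in> U" and T: "holomorphic_map_on U T" and S: "open S" "T ` U \<subseteq> S"
    and \<xi>: "wedge_expansion S K f \<alpha> \<xi>"
    and \<alpha>: "\<And>k a. k \<in> K \<Longrightarrow> a \<in> set (\<alpha> k) \<Longrightarrow> bounded_linear a"
    and \<eta>: "\<And>w vs. w \<in> U \<Longrightarrow> \<eta> w vs = \<xi> (T w) (map (frechet_derivative T (at w)) vs)"
  shows "local_dolbeault b \<eta> z vs = local_dolbeault b \<xi> (T z) (map (frechet_derivative T (at z)) vs)"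
proof -
  define T' where "T' = (\<lambda>w. frechet_derivative T (at w))"
  define B where "B = (\<lambda>v u. frechet_derivative (\<lambda>w. T' w u) (at z) v)"
  define R where "R = (\<lambda>k v us. \<Sum>m<length us. wedge (\<alpha> k) ((map (T' z) us)[m := B v (us ! m)]))"
  have f: "\<And>k. k \<in> K \<Longrightarrow> smooth_on S (f k)"
    and \<xi>_eq: "\<And>y vs. y \<in> S \<Longrightarrow> \<xi> y vs = (\<Sum>k\<in>K. f k y * wedge (\<alpha> k) vs)"
    using \<xi> by (auto simp: wedge_expansion_def)
  have Tz: "T z \<in> S" using U S by auto
  have smT: "smooth_on U T" using T by (simp add: holomorphic_map_on_def)
  have dT: "(T has_derivative T' z) (at z)"
    unfolding T'_def by (rule has_frechet_derivative[OF smooth_on_differentiable[OF smT U(2)]])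
  have dT': "((\<lambda>w. T' w u) has_derivative (\<lambda>v. B v u)) (at z)" for u
    unfolding B_def T'_def
    by (rule has_frechet_derivative[OF smooth_on_differentiable[OF smooth_on_frechet_derivative[OF smT] U(2)]])
  have B_sym: "B v u = B u v" for u v
    unfolding B_def T'_def by (rule second_derivative_symmetric[OF smT U])
  have B_i: "B v (\<i> *s u) = \<i> *s B v u" for u v
  proof -
    have "((\<lambda>w. \<i> *s T' w u) has_derivative (\<lambda>v. \<i> *s B v u)) (at z)"
      by (rule bounded_linear.has_derivative[OF bounded_linear_i_scale dT'])
    then have "((\<lambda>w. T' w (\<i> *s u)) has_derivative (\<lambda>v. \<i> *s B v u)) (at z)"
      by (rule has_derivative_transform_within_open[OF _ U])
        (simp add: T'_def holomorphic_derivative_i_scale[OF T])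
    from frechet_derivative_eq[OF this] show ?thesis by (simp add: B_def)
  qed
  \<comment> \<open>The projection onto a type also inserts \<i> times the vector into the second
    derivative. Cancellation thus needs the symmetry of \<open>B (\<i> *s v) u\<close> as well,
    which follows from complex linearity of \<open>B\<close> in its second argument.\<close>
  have B_i_sym: "B (\<i> *s v) u = B (\<i> *s u) v" for u v
    using B_sym[of "\<i> *s v" u] B_sym[of "\<i> *s u" v] B_sym[of u v] by (simp add: B_i)
  have D: "((\<lambda>w. \<eta> w us) has_derivative
      (\<lambda>v. frechet_derivative (\<lambda>y. \<xi> y (map (T' z) us)) (at (T z)) (T' z v) +
        (\<Sum>k\<in>K. f k (T z) * R k v us))) (at z)" for us
  proof -
    have df: "((\<lambda>w. f k (T w)) has_derivative (\<lambda>v. frechet_derivative (f k) (at (T z)) (T' z v))) (at z)"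
      if "k \<in> K" for k
      using diff_chain_at[OF dT has_frechet_derivative[OF smooth_on_differentiable[OF f[OF that] Tz]]]
      by (simp add: o_def)
    have dw: "((\<lambda>w. wedge (\<alpha> k) (map (T' w) us)) has_derivative (\<lambda>v. R k v us)) (at z)" if "k \<in> K" for k
      unfolding R_def by (rule wedge_has_derivative[OF \<alpha>[OF that] dT'])
    have "((\<lambda>w. \<Sum>k\<in>K. f k (T w) * wedge (\<alpha> k) (map (T' w) us)) has_derivative
        (\<lambda>v. \<Sum>k\<in>K. f k (T z) * R k v us +
          frechet_derivative (f k) (at (T z)) (T' z v) * wedge (\<alpha> k) (map (T' z) us))) (at z)"
      by (intro has_derivative_sum has_derivative_mult df dw)
    then have "((\<lambda>w. \<eta> w us) has_derivative
        (\<lambda>v. \<Sum>k\<in>K. f k (T z) * R k v us +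
          frechet_derivative (f k) (at (T z)) (T' z v) * wedge (\<alpha> k) (map (T' z) us))) (at z)"
    proof (rule has_derivative_transform_within_open[OF _ U])
      fix w assume "w \<in> U"
      then show "(\<Sum>k\<in>K. f k (T w) * wedge (\<alpha> k) (map (T' w) us)) = \<eta> w us"
        using \<eta> \<xi>_eq S(2) by (simp add: T'_def image_subset_iff)
    qed
    then show ?thesis
      by (simp add: frechet_derivative_eq[OF wedge_expansion_has_derivative[OF \<xi> S(1) Tz]] sum.distrib add.commute)
  qed
  have td: "type_derivative b (\<lambda>w. \<eta> w us) z v =
      type_derivative b (\<lambda>y. \<xi> y (map (T' z) us)) (T z) (T' z v) +
      (\<Sum>k\<in>K. f k (T z) / 2 * R k v us + cr_sign b * \<i> * f k (T z) / 2 * R k (\<i> *s v) us)" for us v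
    unfolding type_derivative_def frechet_derivative_eq[OF D] sum.distrib
    using holomorphic_derivative_i_scale[OF T U(2), of v]
    by (simp add: T'_def algebra_simps add_divide_distrib sum_distrib_left sum_divide_distrib)
  have cancel: "(\<Sum>j<length vs. (-1) ^ j * R k (vs ! j) (omit j vs)) = 0"
    "(\<Sum>j<length vs. (-1) ^ j * R k (\<i> *s (vs ! j)) (omit j vs)) = 0" for k
    unfolding R_def
    using wedge_symmetric_insert_cancel[of B, OF B_sym, where vs = vs and \<alpha>s = "\<alpha> k" and A = "T' z"]
      wedge_symmetric_insert_cancel[of "\<lambda>v u. B (\<i> *s v) u", OF B_i_sym, where vs = vs and \<alpha>s = "\<alpha> k" and A = "T' z"]
    by (simp_all cong: sum.cong_simp)
  have "local_dolbeault b \<eta> z vs =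
      (\<Sum>j<length vs. (-1) ^ j * type_derivative b (\<lambda>w. \<eta> w (omit j vs)) z (vs ! j))"
    by (rule local_dolbeault_type_derivative) (rule differentiableI[OF D])
  also have "\<dots> = (\<Sum>j<length vs. (-1) ^ j *
        type_derivative b (\<lambda>y. \<xi> y (map (T' z) (omit j vs))) (T z) (T' z (vs ! j))) +
      (\<Sum>j<length vs. \<Sum>k\<in>K. f k (T z) / 2 * ((-1) ^ j * R k (vs ! j) (omit j vs)) +
        cr_sign b * \<i> * f k (T z) / 2 * ((-1) ^ j * R k (\<i> *s (vs ! j)) (omit j vs)))"
    unfolding td by (simp add: distrib_left sum.distrib sum_distrib_left mult_ac)
  also have "(\<Sum>j<length vs. \<Sum>k\<in>K. f k (T z) / 2 * ((-1) ^ j * R k (vs ! j) (omit j vs)) +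
        cr_sign b * \<i> * f k (T z) / 2 * ((-1) ^ j * R k (\<i> *s (vs ! j)) (omit j vs))) = 0"
    by (subst sum.swap)
      (simp only: sum.distrib sum_distrib_left[symmetric] cancel mult_zero_right sum.neutral_const add_0)
  also have "(\<Sum>j<length vs. (-1) ^ j *
        type_derivative b (\<lambda>y. \<xi> y (map (T' z) (omit j vs))) (T z) (T' z (vs ! j))) + 0 =
      local_dolbeault b \<xi> (T z) (map (T' z) vs)"
    by (simp add: local_dolbeault_type_derivative[OF wedge_expansion_differentiable[OF \<xi> S(1) Tz]] omit_map)
  finally show ?thesis by (simp add: T'_def)
qed

section \<open>Presentations of complex vector spaces\<close>

locale complex_vector_space = vector_space scale
  for scale :: "complex \<Rightarrow> 'v::ab_group_add \<Rightarrow> 'v"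
begin

text \<open>A basis of \<open>C\<close> is extended by vectors of \<open>U\<close> until it spans
  \<open>C\<close> and \<open>U\<close>; \<open>s\<close> kills the basis of \<open>C\<close> and
  fixes the added vectors. For \<open>C = {0}\<close> this is a projection onto
  \<open>U\<close>.\<close>

lemma exists_section_modulo:
  assumes C: "subspace C" and U: "subspace U"
  shows "\<exists>s. Vector_Spaces.linear scale scale s \<and> range s \<subseteq> U \<and> (\<forall>x\<in>C. s x = 0) \<and>
    (\<forall>x\<in>U. x - s x \<in> C)"
proof -
  interpret P: vector_space_pair scale scale ..
  obtain B where B: "B \<subseteq> C" "independent B" "C \<subseteq> span B"
    using maximal_independent_subset[of C] by blast
  have "B \<subseteq> C \<union> U" using B(1) by blast
  then obtain B1 where B1: "B \<subseteq> B1" "B1 \<subseteq> C \<union> U" "independent B1" "C \<union> U \<subseteq> span B1"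
    by (rule maximal_independent_subset_extend[OF _ B(2)])
  define f where "f = (\<lambda>b. if b \<in> B then 0 else b)"
  \<comment> \<open>An added vector outside \<open>U\<close> would lie in \<open>C\<close>, hence in
    the span of \<open>B\<close>, against independence.\<close>
  have "b \<in> U" if "b \<in> B1" "b \<notin> B" for b
  proof (rule ccontr)
    assume "b \<notin> U"
    then have "b \<in> span B" using B1(2) B(3) that by blast
    then have "b \<in> span (B1 - {b})"
      using span_mono[of B "B1 - {b}"] B1(1) that by blast
    then show False using B1(3) that(1) by (auto simp: dependent_def)
  qed
  then have fU: "f ` B1 \<subseteq> U"
    using subspace_0[OF U] by (auto simp: f_def)
  obtain s where s: "Vector_Spaces.linear scale scale s" "\<forall>x\<in>B1. s x = f x" "range s = span (f ` B1)"
    using P.linear_independent_extend_subspace[OF B1(3), of f] by blast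
  interpret s: Vector_Spaces.linear scale scale s by (rule s(1))
  have "s x = 0" if "x \<in> C" for x
  proof -
    have "subspace {x. s x = 0}"
      by (rule subspaceI) (auto simp: s.add s.scale)
    moreover have "B \<subseteq> {x. s x = 0}"
      using s(2) B1(1) by (auto simp: f_def)
    ultimately show ?thesis
      using span_minimal[of B "{x. s x = 0}"] B(3) that by blast
  qed
  moreover have "x - s x \<in> C" if "x \<in> U" for x
  proof -
    have "subspace {x. x - s x \<in> C}"
    proof (rule subspaceI)
      fix x y assume "x \<in> {x. x - s x \<in> C}" "y \<in> {x. x - s x \<in> C}"
      then have "(x - s x) + (y - s y) \<in> C" using subspace_add[OF C] by blast
      then show "x + y \<in> {x. x - s x \<in> C}" by (simp add: s.add algebra_simps)
    next
      fix c x assume "x \<in> {x. x - s x \<in> C}"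
      then have "scale c (x - s x) \<in> C" using subspace_scale[OF C] by blast
      then show "scale c x \<in> {x. x - s x \<in> C}" by (simp add: s.scale scale_right_diff_distrib)
    qed (simp add: subspace_0[OF C])
    moreover have "B1 \<subseteq> {x. x - s x \<in> C}"
      using s(2) B(1) subspace_0[OF C] by (auto simp: f_def)
    ultimately show ?thesis
      using span_minimal[of B1 "{x. x - s x \<in> C}"] B1(4) that by blast
  qed
  moreover have "range s \<subseteq> U"
    unfolding s(3) by (rule span_minimal[OF fU U])
  ultimately show ?thesis using s(1) by blast
qed

lemma subset_sums_left: "subspace W \<Longrightarrow> U \<subseteq> {x + y | x y. x \<in> U \<and> y \<in> W}"
proof
  fix x assume "subspace W" "x \<in> U"
  moreover have "x = x + 0" by simp
  ultimately show "x \<in> {x + y | x y. x \<in> U \<and> y \<in> W}" using subspace_0 by blast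
qed

lemma subset_sums_right: "subspace U \<Longrightarrow> W \<subseteq> {x + y | x y. x \<in> U \<and> y \<in> W}"
proof
  fix y assume "subspace U" "y \<in> W"
  moreover have "y = 0 + y" by simp
  ultimately show "y \<in> {x + y | x y. x \<in> U \<and> y \<in> W}" using subspace_0 by blast
qed

text \<open>Linearity is asked only on \<open>V\<close>, because \<open>del\<close> and
  \<open>delbar\<close> rest on \<open>frechet_derivative\<close>, whose value is unspecified for
  functions that are not differentiable.\<close>

definition linear_map_on :: "'v set \<Rightarrow> ('v \<Rightarrow> 'v) \<Rightarrow> bool" where
  "linear_map_on V L \<longleftrightarrow> subspace V \<and> (\<forall>x\<in>V. \<forall>y\<in>V. L (x + y) = L x + L y) \<and>
     (\<forall>a. \<forall>x\<in>V. L (scale a x) = scale a (L x))"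

lemma linear_map_on_diff:
  assumes "linear_map_on V L" "x \<in> V" "y \<in> V"
  shows "L (x - y) = L x - L y"
proof -
  have "x - y \<in> V" using assms subspace_diff by (auto simp: linear_map_on_def)
  then have "L ((x - y) + y) = L (x - y) + L y"
    using assms unfolding linear_map_on_def by blast
  then show ?thesis by simp
qed

lemma linear_map_on_0: "linear_map_on V L \<Longrightarrow> L 0 = 0"
  using linear_map_on_diff[of V L 0 0] by (auto simp: linear_map_on_def subspace_0)

lemma linear_map_on_subset:
  "linear_map_on V L \<Longrightarrow> subspace V' \<Longrightarrow> V' \<subseteq> V \<Longrightarrow> linear_map_on V' L"
  unfolding linear_map_on_def by blast

lemma subspace_preimage_on:
  assumes L: "linear_map_on V L" and W: "subspace W"
  shows "subspace {x \<in> V. L x \<in> W}"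
  using L subspace_0[OF W] subspace_add[OF W] subspace_scale[OF W] linear_map_on_0[OF L]
  unfolding linear_map_on_def by (intro subspaceI) (simp_all add: subspace_0 subspace_add subspace_scale)

lemma subspace_image_on:
  assumes L: "linear_map_on V L"
  shows "subspace (L ` V)"
proof (rule subspaceI)
  have V: "subspace V" using L by (simp add: linear_map_on_def)
  show "0 \<in> L ` V" using linear_map_on_0[OF L] subspace_0[OF V] by force
  fix x assume x: "x \<in> L ` V"
  show "scale c x \<in> L ` V" for c
    using x L subspace_scale[OF V] unfolding linear_map_on_def by (metis (no_types) image_iff)
  fix y assume "y \<in> L ` V"
  then show "x + y \<in> L ` V"
    using x L subspace_add[OF V] unfolding linear_map_on_def by (metis (no_types) image_iff)
qed

text \<open>The subspace \<open>K\<close> need not be contained in \<open>V\<close>; the kernel of \<open>f\<close> is \<open>V \<inter> K\<close>.\<close>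

definition presents :: "('v \<Rightarrow> 'm) \<Rightarrow> 'v set \<Rightarrow> 'v set \<Rightarrow> 'm cspace \<Rightarrow> bool" where
  "presents f V K M \<longleftrightarrow> subspace V \<and> f ` V = carrier M \<and>
     (\<forall>x\<in>V. \<forall>y\<in>V. f (x + y) = f x \<oplus>\<^bsub>M\<^esub> f y) \<and>
     (\<forall>a. \<forall>x\<in>V. f (scale a x) = a \<odot>\<^bsub>M\<^esub> f x) \<and>
     (\<forall>x\<in>V. \<forall>y\<in>V. f x = f y \<longleftrightarrow> x - y \<in> K)"

lemma presentsD:
  assumes "presents f V K M"
  shows "subspace V" "f ` V = carrier M"
    "x \<in> V \<Longrightarrow> y \<in> V \<Longrightarrow> f x \<oplus>\<^bsub>M\<^esub> f y = f (x + y)"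
    "x \<in> V \<Longrightarrow> a \<odot>\<^bsub>M\<^esub> f x = f (scale a x)"
    "x \<in> V \<Longrightarrow> y \<in> V \<Longrightarrow> f x = f y \<longleftrightarrow> x - y \<in> K"
  using assms unfolding presents_def by (blast | metis)+

lemma presents_restrict:
  assumes "presents f V K M" "subspace V'" "V' \<subseteq> V"
  shows "presents f V' K (M\<lparr>carrier := f ` V'\<rparr>)"
  using assms unfolding presents_def by (auto simp: subset_iff)

text \<open>Sending \<open>f x\<close> to \<open>g x\<close> is well defined and injective, since
  both maps identify the same pairs of vectors; \<open>inv_into\<close> merely picks a
  representative.\<close>

lemma presents_iso:
  assumes f: "presents f V K M" and g: "presents g V K N"
  shows "M \<cong>\<^sub>v N"
proof -
  define h where "h = (\<lambda>m. g (inv_into V f m))"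
  have h: "h (f x) = g x" if "x \<in> V" for x
  proof -
    have "inv_into V f (f x) \<in> V" "f (inv_into V f (f x)) = f x"
      using that by (auto simp: inv_into_into f_inv_into_f)
    then show ?thesis
      using presentsD(5)[OF f] presentsD(5)[OF g] that unfolding h_def by blast
  qed
  have "bij_betw h (carrier M) (carrier N)"
  proof (intro bij_betwI')
    fix m m' assume "m \<in> carrier M" "m' \<in> carrier M"
    then obtain x x' where "x \<in> V" "x' \<in> V" "m = f x" "m' = f x'"
      using presentsD(2)[OF f] by blast
    then show "h m = h m' \<longleftrightarrow> m = m'"
      using presentsD(5)[OF f] presentsD(5)[OF g] by (simp add: h)
  next
    fix m assume "m \<in> carrier M"
    then obtain x where "x \<in> V" "m = f x" using presentsD(2)[OF f] by blast
    then show "h m \<in> carrier N" using presentsD(2)[OF g] by (auto simp: h)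
  next
    fix n assume "n \<in> carrier N"
    then obtain x where "x \<in> V" "n = g x" using presentsD(2)[OF g] by blast
    then show "\<exists>m\<in>carrier M. n = h m"
      using presentsD(2)[OF f] by (auto simp: h intro!: bexI[of _ "f x"])
  qed
  moreover have "h (m \<oplus>\<^bsub>M\<^esub> m') = h m \<oplus>\<^bsub>N\<^esub> h m'" if m: "m \<in> carrier M" "m' \<in> carrier M" for m m'
  proof -
    obtain x x' where "x \<in> V" "x' \<in> V" "m = f x" "m' = f x'"
      using m presentsD(2)[OF f] by blast
    then show ?thesis
      using subspace_add[OF presentsD(1)[OF f], of x x']
      by (simp add: presentsD(3)[OF f] presentsD(3)[OF g] h)
  qed
  moreover have "h (c \<odot>\<^bsub>M\<^esub> m) = c \<odot>\<^bsub>N\<^esub> h m" if m: "m \<in> carrier M" for c m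
  proof -
    obtain x where "x \<in> V" "m = f x"
      using m presentsD(2)[OF f] by blast
    then show ?thesis
      using subspace_scale[OF presentsD(1)[OF f], of x c]
      by (simp add: presentsD(4)[OF f] presentsD(4)[OF g] h)
  qed
  ultimately show ?thesis
    unfolding space_iso_def by blast
qed

text \<open>A coset in \<open>M\<close> is described by its representatives in \<open>V\<close>, so
  that quotients of quotients can be treated without unfolding the inner one.\<close>

lemma presents_coset:
  assumes f: "presents f V K M" and W: "subspace W" "W \<subseteq> V" and x: "x \<in> V"
  shows "f ` W +>\<^bsub>M\<^esub> f x = f ` {y \<in> V. y - x \<in> W}"
proof -
  have "f ` W +>\<^bsub>M\<^esub> f x = (\<lambda>w. f (w + x)) ` W"
    using presentsD(3)[OF f] W(2) x by (auto simp: a_r_coset_def' image_iff subset_iff)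
  also have "\<dots> = f ` {y \<in> V. y - x \<in> W}"
  proof (intro equalityI subsetI)
    fix m assume "m \<in> (\<lambda>w. f (w + x)) ` W"
    then obtain w where w: "w \<in> W" "m = f (w + x)" by blast
    then show "m \<in> f ` {y \<in> V. y - x \<in> W}"
      using subspace_add[OF presentsD(1)[OF f], of w x] W(2) x by (auto intro!: imageI)
  next
    fix m assume "m \<in> f ` {y \<in> V. y - x \<in> W}"
    then obtain y where "y - x \<in> W" "m = f y" by blast
    then show "m \<in> (\<lambda>w. f (w + x)) ` W"
      by (intro image_eqI[of _ _ "y - x"]) simp_all
  qed
  finally show ?thesis .
qed

text \<open>The third isomorphism theorem. The inclusion \<open>V \<inter> K \<subseteq> W\<close>
  ensures that vectors with the same image under \<open>f\<close> are congruent modulo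
  \<open>W\<close>.\<close>

lemma presents_quot_space:
  assumes f: "presents f V K M" and W: "subspace W" "W \<subseteq> V" "V \<inter> K \<subseteq> W"
  shows "presents (\<lambda>x. f ` W +>\<^bsub>M\<^esub> f x) V W (quot_space M (f ` W))"
proof -
  let ?cos = "\<lambda>x. f ` {y \<in> V. y - x \<in> W}"
  note V = presentsD(1)[OF f]
  note cos = presents_coset[OF f W(1,2)]
  have car: "carrier (quot_space M (f ` W)) = (\<lambda>x. f ` W +>\<^bsub>M\<^esub> f x) ` V"
    by (auto simp: quot_space_def A_RCOSETS_def' presentsD(2)[OF f, symmetric])
  have add: "?cos (x + y) = ?cos x <+>\<^bsub>M\<^esub> ?cos y" if xy: "x \<in> V" "y \<in> V" for x y
  proof (intro equalityI subsetI)
    fix m assume "m \<in> ?cos (x + y)"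
    then obtain z where z: "z \<in> V" "z - (x + y) \<in> W" "m = f z" by blast
    have "f (z - y) \<in> ?cos x"
      using z xy subspace_diff[OF V] by (auto intro!: imageI simp: algebra_simps)
    moreover have "f y \<in> ?cos y"
      using xy subspace_0[OF W(1)] by (auto intro!: imageI)
    moreover have "m = f (z - y) \<oplus>\<^bsub>M\<^esub> f y"
      using z xy subspace_diff[OF V] by (simp add: presentsD(3)[OF f])
    ultimately show "m \<in> ?cos x <+>\<^bsub>M\<^esub> ?cos y"
      unfolding set_add_def' by blast
  next
    fix m assume "m \<in> ?cos x <+>\<^bsub>M\<^esub> ?cos y"
    then obtain u v where uv: "u \<in> V" "u - x \<in> W" "v \<in> V" "v - y \<in> W" "m = f u \<oplus>\<^bsub>M\<^esub> f v"
      unfolding set_add_def' by blast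
    then have "(u - x) + (v - y) \<in> W" using subspace_add[OF W(1)] by blast
    then have "u + v - (x + y) \<in> W" by (simp add: algebra_simps)
    then show "m \<in> ?cos (x + y)"
      using uv subspace_add[OF V] by (auto simp: presentsD(3)[OF f] intro!: imageI)
  qed
  \<comment> \<open>\<open>quot_space\<close> defines a scalar multiple as a union over all members
    of the coset; the sets in this union all coincide.\<close>
  have smult: "?cos (scale c x) = (\<Union>m\<in>?cos x. f ` W +>\<^bsub>M\<^esub> (c \<odot>\<^bsub>M\<^esub> m))" if x: "x \<in> V" for c x
  proof -
    have "f ` W +>\<^bsub>M\<^esub> (c \<odot>\<^bsub>M\<^esub> f y) = ?cos (scale c x)" if y: "y \<in> V" "y - x \<in> W" for y
    proof -
      have "scale c (y - x) \<in> W" by (rule subspace_scale[OF W(1) y(2)])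
      then have "z - scale c y \<in> W \<longleftrightarrow> z - scale c x \<in> W" for z
        using subspace_add[OF W(1), of "z - scale c y" "scale c (y - x)"]
          subspace_diff[OF W(1), of "z - scale c x" "scale c (y - x)"]
        by (auto simp: scale_right_diff_distrib)
      then show ?thesis
        using y subspace_scale[OF V, of y c] by (simp add: presentsD(4)[OF f] cos)
    qed
    moreover have "x \<in> {y \<in> V. y - x \<in> W}" using x subspace_0[OF W(1)] by simp
    ultimately show ?thesis by blast
  qed
  have ker: "?cos x = ?cos y \<longleftrightarrow> x - y \<in> W" if xy: "x \<in> V" "y \<in> V" for x y
  proof
    assume "?cos x = ?cos y"
    moreover have "f x \<in> ?cos x" using xy subspace_0[OF W(1)] by (auto intro!: imageI)
    ultimately obtain z where z: "z \<in> V" "z - y \<in> W" "f x = f z" by blast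
    then have "x - z \<in> W"
      using presentsD(5)[OF f xy(1) z(1)] subspace_diff[OF V xy(1) z(1)] W(3) by blast
    then show "x - y \<in> W" using subspace_add[OF W(1) _ z(2), of "x - z"] by simp
  next
    assume "x - y \<in> W"
    then have "z - x \<in> W \<longleftrightarrow> z - y \<in> W" for z
      using subspace_add[OF W(1), of "z - x" "x - y"] subspace_diff[OF W(1), of "z - y" "x - y"]
      by auto
    then show "?cos x = ?cos y" by simp
  qed
  show ?thesis
    unfolding presents_def
  proof (intro conjI ballI allI)
    show "(\<lambda>x. f ` W +>\<^bsub>M\<^esub> f x) ` V = carrier (quot_space M (f ` W))"
      using car by simp
  next
    fix x y assume xy: "x \<in> V" "y \<in> V"
    then show "f ` W +>\<^bsub>M\<^esub> f (x + y) = (f ` W +>\<^bsub>M\<^esub> f x) \<oplus>\<^bsub>quot_space M (f ` W)\<^esub> (f ` W +>\<^bsub>M\<^esub> f y)"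
      using subspace_add[OF V xy] add[OF xy] by (simp add: cos quot_space_def)
    show "(f ` W +>\<^bsub>M\<^esub> f x = f ` W +>\<^bsub>M\<^esub> f y) = (x - y \<in> W)"
      using ker[OF xy] xy by (simp add: cos)
  next
    fix c x assume x: "x \<in> V"
    then show "f ` W +>\<^bsub>M\<^esub> f (scale c x) = c \<odot>\<^bsub>quot_space M (f ` W)\<^esub> (f ` W +>\<^bsub>M\<^esub> f x)"
      using subspace_scale[OF V x] smult[OF x] by (simp add: cos[OF x] cos quot_space_def)
  qed (rule V)
qed

lemma induced_coset:
  assumes "x \<in> V" "subspace W" "\<And>y. y \<in> V \<Longrightarrow> y - x \<in> W \<Longrightarrow> \<phi> (f y) = c"
  shows "induced \<phi> (f ` {y \<in> V. y - x \<in> W}) = c"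
proof -
  have "x \<in> {y \<in> V. y - x \<in> W}" using assms(1) subspace_0[OF assms(2)] by simp
  then have "\<phi> ` f ` {y \<in> V. y - x \<in> W} = {c}" using assms(3) by blast
  then show ?thesis by (simp add: induced_def)
qed

text \<open>The chain is \<open>B \<subseteq> C \<subseteq> C + N \<subseteq> V\<close>, and its
  middle quotient is \<open>N / (N \<inter> C)\<close> by the second isomorphism theorem. Of the
  three maps only \<open>g\<close> is given on \<open>V\<close>; \<open>k\<close> and
  \<open>l\<close> are extended to \<open>V\<close> by composing them with linear maps into
  \<open>N\<close> and onto \<open>C\<close>.\<close>

lemma presents_filtration:
  assumes g: "presents g V {x + y | x y. x \<in> C \<and> y \<in> N} L" and k: "presents k N (N \<inter> C) M"
    and l: "presents l C B P" and B: "B \<subseteq> C" and sub: "{x + y | x y. x \<in> C \<and> y \<in> N} \<subseteq> V"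
  shows "\<exists>h. presents h V B (L \<oplus>\<^sub>v M \<oplus>\<^sub>v P)"
proof -
  let ?D = "{x + y | x y. x \<in> C \<and> y \<in> N}" and ?sum = "L \<oplus>\<^sub>v M \<oplus>\<^sub>v P"
  have V: "subspace V" and N: "subspace N" and C: "subspace C"
    using presentsD(1)[OF g] presentsD(1)[OF k] presentsD(1)[OF l] .
  have D: "subspace ?D" by (rule subspace_sums[OF C N])
  have CD: "C \<subseteq> ?D" by (rule subset_sums_left[OF N])
  have ND: "N \<subseteq> ?D" by (rule subset_sums_right[OF C])
  have K: "subspace (N \<inter> C)" by (rule subspace_inter[OF N C])
  obtain m where m: "Vector_Spaces.linear scale scale m" "range m \<subseteq> N"
      "\<And>x. x \<in> C \<Longrightarrow> m x = 0" "\<And>x. x \<in> N \<Longrightarrow> x - m x \<in> C"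
    using exists_section_modulo[OF C N] by blast
  obtain r where r: "Vector_Spaces.linear scale scale r" "range r \<subseteq> C"
      "\<And>x. x \<in> C \<Longrightarrow> x - r x \<in> {0}"
    using exists_section_modulo[OF subspace_single_0 C] by blast
  interpret m: Vector_Spaces.linear scale scale m by (rule m(1))
  interpret r: Vector_Spaces.linear scale scale r by (rule r(1))
  have rC: "r x = x" if "x \<in> C" for x using r(3)[OF that] by simp
  have mN: "m x \<in> N" and rr: "r x \<in> C" for x using m(2) r(2) by auto
  have mm: "x - m x \<in> N \<inter> C" if "x \<in> N" for x
    using m(4)[OF that] subspace_diff[OF N that mN] by blast
  define h where "h = (\<lambda>x. (g x, k (m x), l (r x)))"
  have surj: "(g x, k y, l z) \<in> h ` V" if x: "x \<in> V" and y: "y \<in> N" and z: "z \<in> C" for x y z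
  proof -
    \<comment> \<open>\<open>x - m x + y\<close> has the class of \<open>x\<close> under
      \<open>g\<close>, and its image under \<open>m\<close> has the class of \<open>y\<close> under
      \<open>k\<close>. Adding an element of \<open>C\<close> changes neither class;
      \<open>c\<close> is chosen to correct the value of \<open>r\<close> to
      \<open>z\<close>.\<close>
    define c where "c = z - r (x - m x + y)"
    define w where "w = x - m x + y + c"
    have c: "c \<in> C" unfolding c_def by (rule subspace_diff[OF C z rr])
    have "(y - m x) + c \<in> ?D"
      by (rule subspace_add[OF D subspace_diff[OF D subsetD[OF ND y] subsetD[OF ND mN]] subsetD[OF CD c]])
    moreover have "(y - m x) + c = w - x" by (simp add: w_def algebra_simps)
    ultimately have wD: "w - x \<in> ?D" by (simp only:)
    have "(w - x) + x \<in> V"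
      by (rule subspace_add[OF V subsetD[OF sub wD] x])
    then have wV: "w \<in> V" by (simp only: diff_add_cancel)
    have "m w - y = (m x - m (m x)) - (y - m y)"
      by (simp add: w_def m.add m.diff m(3)[OF c])
    then have "m w - y \<in> N \<inter> C"
      by (simp only: subspace_diff[OF K mm[OF mN] mm[OF y]])
    then have "k (m w) = k y"
      using presentsD(5)[OF k mN y] by (simp only:)
    moreover have "r w = r (x - m x + y) + c"
      by (simp only: w_def r.add[of _ c] rC[OF c])
    then have "r w = z" by (simp add: c_def)
    moreover have "g w = g x"
      using presentsD(5)[OF g wV x] wD by (simp only:)
    ultimately have "h w = (g x, k y, l z)" by (simp only: h_def)
    then show ?thesis using wV by (metis imageI)
  qed
  have car: "carrier ?sum = g ` V \<times> k ` N \<times> l ` C"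
    unfolding direct_sum_def partial_object.select_convs
    by (simp only: presentsD(2)[OF g] presentsD(2)[OF k] presentsD(2)[OF l])
  have "h ` V \<subseteq> g ` V \<times> k ` N \<times> l ` C"
    using mN rr by (auto simp: h_def)
  moreover have "g ` V \<times> k ` N \<times> l ` C \<subseteq> h ` V"
    using surj by blast
  ultimately have onto: "h ` V = carrier ?sum"
    unfolding car by blast
  have add: "h (x + y) = h x \<oplus>\<^bsub>?sum\<^esub> h y" if xy: "x \<in> V" "y \<in> V" for x y
    by (simp add: h_def direct_sum_def m.add r.add presentsD(3)[OF g xy]
        presentsD(3)[OF k mN mN] presentsD(3)[OF l rr rr])
  have scale: "h (scale a x) = a \<odot>\<^bsub>?sum\<^esub> h x" if x: "x \<in> V" for a x
    by (simp add: h_def direct_sum_def m.scale r.scale presentsD(4)[OF g x]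
        presentsD(4)[OF k mN] presentsD(4)[OF l rr])
  have ker: "h x = h y \<longleftrightarrow> x - y \<in> B" if xy: "x \<in> V" "y \<in> V" for x y
  proof -
    have "h x = h y \<longleftrightarrow> x - y \<in> ?D \<and> m (x - y) \<in> N \<inter> C \<and> r (x - y) \<in> B"
      unfolding h_def prod.inject presentsD(5)[OF g xy] presentsD(5)[OF k mN mN]
        presentsD(5)[OF l rr rr] m.diff r.diff ..
    also have "\<dots> \<longleftrightarrow> x - y \<in> B"
    proof
      \<comment> \<open>The components are used from left to right: the first gives
        \<open>x - y = c + n\<close>, the second puts \<open>n\<close> and with it
        \<open>x - y\<close> into \<open>C\<close>, where \<open>r\<close> is the identity, so that
        the third applies.\<close>
      assume *: "x - y \<in> ?D \<and> m (x - y) \<in> N \<inter> C \<and> r (x - y) \<in> B"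
      then obtain c n where c: "c \<in> C" and n: "n \<in> N" and eq: "x - y = c + n" by blast
      have "m (x - y) = m n" by (simp only: eq m.add m(3)[OF c] add_0)
      then have "m n \<in> C" using * by simp
      from subspace_add[OF C subspace_add[OF C c m(4)[OF n]] this] have "x - y \<in> C"
        by (simp add: eq)
      from rC[OF this] * show "x - y \<in> B" by simp
    next
      assume xyB: "x - y \<in> B"
      then have xyC: "x - y \<in> C" using B by blast
      then show "x - y \<in> ?D \<and> m (x - y) \<in> N \<inter> C \<and> r (x - y) \<in> B"
        unfolding m(3)[OF xyC] rC[OF xyC] using xyB CD subspace_0[OF K] by blast
    qed
    finally show ?thesis .
  qed
  have "presents h V B ?sum"
    unfolding presents_def using V onto add scale ker by blast
  then show ?thesis by blast
qed

end

section \<open>The double complex of forms\<close>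

text \<open>Together with pointwise addition this makes the whole function type a vector space, in
  which the spaces of forms are subspaces.\<close>

definition form_scale :: "complex \<Rightarrow> ('a, 'n) form \<Rightarrow> ('a, 'n) form" where
  "form_scale a \<omega> = (\<lambda>c z vs. a * \<omega> c z vs)"

lemma bounded_linear_covector: "bounded_linear (covector b i)"
proof (cases b)
  case True
  then show ?thesis by (simp add: covector_def[abs_def] bounded_linear_vec_nth)
next
  case False
  then show ?thesis
    using bounded_linear_compose[OF bounded_linear_cnj bounded_linear_vec_nth]
    by (simp add: covector_def[abs_def])
qed

lemma local_dolbeault_zero: "local_dolbeault b (\<lambda>z vs. 0) z vs = 0"
  by (simp add: local_dolbeault_def wirtinger_eq)

lemma dolbeault_zero: "dolbeault b 0 = 0"
  by (intro ext) (simp add: dolbeault_eq zero_fun_def local_dolbeault_zero)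

lemma zero_forms: "0 \<in> forms \<A> p q"
proof -
  have "local_form (nat p) (nat q) S (\<lambda>z vs. 0)" for S :: "(complex^'b) set"
    unfolding local_form_def by (intro conjI exI[of _ "\<lambda>I J z. 0"]) (auto simp: smooth_on_const)
  then show ?thesis
    by (auto simp: forms_def zero_fun_def)
qed

lemma local_form_add:
  assumes S: "open S" and "local_form p q S \<eta>" "local_form p q S \<theta>"
  shows "local_form p q S (\<lambda>z vs. \<eta> z vs + \<theta> z vs)"
proof -
  let ?K = "{I. length I = p} \<times> {J. length J = q}"
  obtain f g where fg: "wedge_expansion S ?K f (\<lambda>(I, J). coframe I J) \<eta>" "wedge_expansion S ?K g (\<lambda>(I, J). coframe I J) \<theta>"
    and 0: "\<And>z vs. z \<notin> S \<Longrightarrow> \<eta> z vs = 0" "\<And>z vs. z \<notin> S \<Longrightarrow> \<theta> z vs = 0"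
    using assms by (auto simp: local_form_iff)
  then have "wedge_expansion S ?K (\<lambda>k z. f k z + g k z) (\<lambda>(I, J). coframe I J) (\<lambda>z vs. \<eta> z vs + \<theta> z vs)"
    unfolding wedge_expansion_def by (simp add: smooth_on_add[OF S] distrib_right sum.distrib)
  with 0 show ?thesis unfolding local_form_iff by auto
qed

lemma local_form_scale:
  assumes S: "open S" and "local_form p q S \<eta>"
  shows "local_form p q S (\<lambda>z vs. a * \<eta> z vs)"
proof -
  let ?K = "{I. length I = p} \<times> {J. length J = q}"
  obtain f where f: "wedge_expansion S ?K f (\<lambda>(I, J). coframe I J) \<eta>"
    and 0: "\<And>z vs. z \<notin> S \<Longrightarrow> \<eta> z vs = 0"
    using assms by (auto simp: local_form_iff)
  then have "wedge_expansion S ?K (\<lambda>k z. a * f k z) (\<lambda>(I, J). coframe I J) (\<lambda>z vs. a * \<eta> z vs)"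
    unfolding wedge_expansion_def by (simp add: smooth_on_cmult[OF S] sum_distrib_left mult.assoc)
  with 0 show ?thesis unfolding local_form_iff by auto
qed

interpretation form: complex_vector_space form_scale
  by unfold_locales (auto simp: form_scale_def fun_eq_iff algebra_simps)

lemma form_space_simps:
  "\<zero>\<^bsub>form_space\<^esub> = 0" "x \<oplus>\<^bsub>form_space\<^esub> y = x + y" "a \<odot>\<^bsub>form_space\<^esub> x = form_scale a x"
  by (simp_all add: form_space_def form_scale_def zero_fun_def plus_fun_def)

lemma form_set_add: "U <+>\<^bsub>form_space\<^esub> W = {x + y | x y. x \<in> U \<and> y \<in> W}"
  by (auto simp: set_add_def' form_space_simps)

lemma form_presents_id:
  "form.subspace V \<Longrightarrow> form.presents id V {0} (form_space\<lparr>carrier := V\<rparr>)"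
  by (simp add: form.presents_def form_space_simps)

lemma form_presents_quot:
  assumes "form.subspace V" "form.subspace W" "W \<subseteq> V"
  shows "form.presents (\<lambda>x. W +>\<^bsub>form_space\<^esub> x) V W (quot_space (form_space\<lparr>carrier := V\<rparr>) W)"
proof -
  have "V \<inter> {0} \<subseteq> W" using form.subspace_0[OF assms(2)] by blast
  from form.presents_quot_space[OF form_presents_id[OF assms(1)] assms(2,3) this]
  show ?thesis by (simp add: a_r_coset_def')
qed

lemma form_coset:
  assumes "form.subspace V" "form.subspace W" "W \<subseteq> V" "x \<in> V"
  shows "W +>\<^bsub>form_space\<^esub> x = id ` {y \<in> V. y - x \<in> W}"
  using form.presents_coset[OF form_presents_id[OF assms(1)] assms(2-4)] by (simp add: a_r_coset_def')

text \<open>The forms \<open>N\<close>, \<open>C\<close> and \<open>D\<close> of the introduction are \<open>ker_del_reps\<close>, \<open>del_L_reps\<close> and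
  \<open>H_del_reps\<close>.\<close>

definition ker_del_reps :: "('a, 'n::finite) chart set \<Rightarrow> int \<Rightarrow> int \<Rightarrow> ('a, 'n) form set" where
  "ker_del_reps \<A> p q = {\<theta> \<in> ker_delbar \<A> p q. del \<theta> \<in> im_delbar \<A> (p + 1) q}"

definition del_L_reps :: "('a, 'n::finite) chart set \<Rightarrow> int \<Rightarrow> int \<Rightarrow> ('a, 'n) form set" where
  "del_L_reps \<A> p q = {x + y | x y. x \<in> im_delbar \<A> p q \<and> y \<in> del ` ker_del_delbar \<A> (p - 1) q}"

definition K_num :: "('a, 'n::finite) chart set \<Rightarrow> int \<Rightarrow> int \<Rightarrow> ('a, 'n) form set" where
  "K_num \<A> p q = ker_del \<A> p q \<inter> ker_delbar \<A> p q"

definition K_den :: "('a, 'n::finite) chart set \<Rightarrow> int \<Rightarrow> int \<Rightarrow> ('a, 'n) form set" where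
  "K_den \<A> p q =
     (im_del \<A> p q \<inter> ker_delbar \<A> p q) <+>\<^bsub>form_space\<^esub> (im_delbar \<A> p q \<inter> ker_del \<A> p q)"

definition H_del_reps :: "('a, 'n::finite) chart set \<Rightarrow> int \<Rightarrow> int \<Rightarrow> ('a, 'n) form set" where
  "H_del_reps \<A> p q = {x + y | x y. x \<in> del_L_reps \<A> p q \<and> y \<in> K_num \<A> p q}"

context
  fixes X :: "'a topology" and \<A> :: "('a, 'n::finite) chart set"
  assumes atlas: "holomorphic_atlas X \<A>"
begin

section \<open>Charts and the local expressions of forms\<close>

lemma chart_properties:
  assumes "c \<in> \<A>"
  shows chart_openin: "openin X (fst c)" and chart_image_open: "open (snd c ` fst c)"
    and chart_homeomorphic:
      "homeomorphic_map (subtopology X (fst c)) (top_of_set (snd c ` fst c)) (snd c)"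
  using atlas assms by (auto simp: holomorphic_atlas_def complex_chart_def case_prod_unfold)

lemma chart_inj: "c \<in> \<A> \<Longrightarrow> inj_on (snd c) (fst c)"
  using homeomorphic_imp_injective_map[OF chart_homeomorphic, of c]
    openin_subset[OF chart_openin, of c] by (simp add: inf.absorb2)

lemma overlap_open:
  assumes "c \<in> \<A>" "d \<in> \<A>"
  shows "open (snd c ` (fst c \<inter> fst d))"
proof -
  have "openin (subtopology X (fst c)) (fst c \<inter> fst d)"
    using chart_openin[OF assms(2)] by (simp add: openin_subtopology_Int2)
  then have "openin (top_of_set (snd c ` fst c)) (snd c ` (fst c \<inter> fst d))"
    using homeomorphic_imp_open_map[OF chart_homeomorphic[OF assms(1)]] by (simp add: open_map_def)
  then show ?thesis
    using openin_open_eq[OF chart_image_open[OF assms(1)]] by blast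
qed

lemma transition_apply: "c \<in> \<A> \<Longrightarrow> x \<in> fst c \<Longrightarrow> transition c d (snd c x) = snd d x"
  by (simp add: transition_def chart_inj)

lemma forms_local:
  assumes "\<omega> \<in> forms \<A> p q" and nonneg: "\<not> (p < 0 \<or> q < 0)" and "c \<in> \<A>"
  shows "local_form (nat p) (nat q) (snd c ` fst c) (\<omega> c)"
  using assms unfolding forms_def if_not_P[OF nonneg] by blast

text \<open>Bounded linearity of the covectors is what the product rule for \<open>wedge\<close>
  asks for. In negative degree the only form is zero, which is expanded over the empty index
  set.\<close>

lemma forms_expansion:
  assumes \<omega>: "\<omega> \<in> forms \<A> p q" and c: "c \<in> \<A>"
  shows "\<exists>(K :: ('n list \<times> 'n list) set) f \<alpha>. wedge_expansion (snd c ` fst c) K f \<alpha> (\<omega> c) \<and>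
    (\<forall>k\<in>K. \<forall>a\<in>set (\<alpha> k). bounded_linear a)"
proof (cases "p < 0 \<or> q < 0")
  case True
  then have "\<omega> = (\<lambda>c z vs. 0)" using \<omega> by (simp add: forms_def)
  then show ?thesis
    by (intro exI[of _ "{}"]) (auto simp: wedge_expansion_def)
next
  case False
  from forms_local[OF \<omega> False c] obtain f where
    f: "wedge_expansion (snd c ` fst c) ({I. length I = nat p} \<times> {J. length J = nat q}) f
      (\<lambda>(I, J). coframe I J) (\<omega> c)"
    by (auto simp: local_form_iff)
  moreover have "bounded_linear a"
    if "a \<in> set (case k of (I, J) \<Rightarrow> coframe I J)" for k :: "'n list \<times> 'n list" and a
    using that by (auto simp: coframe_def bounded_linear_covector split: prod.splits)
  ultimately show ?thesis by blast
qed

lemma forms_differentiable: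
  assumes "\<omega> \<in> forms \<A> p q" "c \<in> \<A>" "z \<in> snd c ` fst c"
  shows "(\<lambda>w. \<omega> c w vs) differentiable (at z)"
proof -
  obtain K :: "('n list \<times> 'n list) set" and f \<alpha>
    where "wedge_expansion (snd c ` fst c) K f \<alpha> (\<omega> c)"
    using forms_expansion[OF assms(1,2)] by blast
  then show ?thesis
    by (rule wedge_expansion_differentiable[OF _ chart_image_open[OF assms(2)] assms(3)])
qed

lemma forms_outside:
  assumes "\<omega> \<in> forms \<A> p q" "c \<notin> \<A>"
  shows "\<omega> c = (\<lambda>z vs. 0)"
proof (cases "p < 0 \<or> q < 0")
  case True
  then show ?thesis using assms by (simp add: forms_def)
next
  case False
  then show ?thesis using assms unfolding forms_def if_not_P[OF False] by blast
qed

lemma forms_pullback: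
  assumes \<omega>: "\<omega> \<in> forms \<A> p q" and "c \<in> \<A>" "d \<in> \<A>" "x \<in> fst c \<inter> fst d"
  shows "\<omega> c (snd c x) vs =
    \<omega> d (snd d x) (map (frechet_derivative (transition c d) (at (snd c x))) vs)"
proof (cases "p < 0 \<or> q < 0")
  case True
  then show ?thesis using \<omega> by (simp add: forms_def)
next
  case False
  then show ?thesis using assms unfolding forms_def if_not_P[OF False] by blast
qed

lemma formsI:
  assumes "\<not> (p < 0 \<or> q < 0)"
    and "\<And>c. c \<notin> \<A> \<Longrightarrow> \<omega> c = (\<lambda>z vs. 0)"
    and "\<And>c. c \<in> \<A> \<Longrightarrow> local_form (nat p) (nat q) (snd c ` fst c) (\<omega> c)"
    and "\<And>c d x vs. c \<in> \<A> \<Longrightarrow> d \<in> \<A> \<Longrightarrow> x \<in> fst c \<inter> fst d \<Longrightarrow> \<omega> c (snd c x) vs =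
      \<omega> d (snd d x) (map (frechet_derivative (transition c d) (at (snd c x))) vs)"
  shows "\<omega> \<in> forms \<A> p q"
  unfolding forms_def if_not_P[OF assms(1)] using assms(2-4) by blast

text \<open>Inside a chart this is the computation of the bidegree; between charts it is invariance
  under the holomorphic transition maps.\<close>

lemma dolbeault_forms:
  assumes \<omega>: "\<omega> \<in> forms \<A> p q"
  shows "dolbeault b \<omega> \<in> forms \<A> (if b then p + 1 else p) (if b then q else q + 1)"
proof (cases "p < 0 \<or> q < 0")
  case True
  then have "\<omega> = 0" using \<omega> by (simp add: forms_def zero_fun_def)
  \<comment> \<open>For \<open>p = -1\<close> or \<open>q = -1\<close> the target bidegree may be
    nonnegative; it contains the zero form in any case.\<close>
  then show ?thesis by (simp only: dolbeault_zero zero_forms)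
next
  case False
  then have nonneg: "\<not> ((if b then p + 1 else p) < 0 \<or> (if b then q else q + 1) < 0)" by auto
  let ?p = "if b then p + 1 else p" and ?q = "if b then q else q + 1"
  have 1: "dolbeault b \<omega> c = (\<lambda>z vs. 0)" if "c \<notin> \<A>" for c
    using forms_outside[OF \<omega> that] by (intro ext) (simp add: dolbeault_eq local_dolbeault_zero)
  have 2: "local_form (nat ?p) (nat ?q) (snd c ` fst c) (dolbeault b \<omega> c)" if c: "c \<in> \<A>" for c
  proof -
    have lf: "local_form (nat p) (nat q) (snd c ` fst c) (\<omega> c)"
      by (rule forms_local[OF \<omega> False c])
    show ?thesis
    proof (cases b)
      case True
      have "local_form (Suc (nat p)) (nat q) (snd c ` fst c) (dolbeault b \<omega> c)"
        by (rule local_form_del[OF lf chart_image_open[OF c]]) (simp_all add: dolbeault_eq True)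
      then show ?thesis using True False by (simp add: nat_add_distrib)
    next
      case b: False
      have "local_form (nat p) (Suc (nat q)) (snd c ` fst c) (dolbeault b \<omega> c)"
        by (rule local_form_delbar[OF lf chart_image_open[OF c]]) (simp_all add: dolbeault_eq b)
      then show ?thesis using b False by (simp add: nat_add_distrib)
    qed
  qed
  have 3: "dolbeault b \<omega> c (snd c x) vs =
      dolbeault b \<omega> d (snd d x) (map (frechet_derivative (transition c d) (at (snd c x))) vs)"
    if c: "c \<in> \<A>" and d: "d \<in> \<A>" and x: "x \<in> fst c \<inter> fst d" for c d x vs
  proof -
    let ?U = "snd c ` (fst c \<inter> fst d)"
    obtain K :: "('n list \<times> 'n list) set" and f \<alpha>
      where exp: "wedge_expansion (snd d ` fst d) K f \<alpha> (\<omega> d)"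
        and \<alpha>: "\<And>k a. k \<in> K \<Longrightarrow> a \<in> set (\<alpha> k) \<Longrightarrow> bounded_linear a"
      using forms_expansion[OF \<omega> d] by blast
    have "local_dolbeault b (\<omega> c) (snd c x) vs = local_dolbeault b (\<omega> d) (transition c d (snd c x))
        (map (frechet_derivative (transition c d) (at (snd c x))) vs)"
    proof (rule local_dolbeault_pullback[OF overlap_open[OF c d] _ _ chart_image_open[OF d] _ exp \<alpha>])
      show "holomorphic_map_on ?U (transition c d)"
        using atlas c d by (simp add: holomorphic_atlas_def)
      show "transition c d ` ?U \<subseteq> snd d ` fst d"
        by (auto simp: transition_apply[OF c])
      show "\<omega> c w vs = \<omega> d (transition c d w) (map (frechet_derivative (transition c d) (at w)) vs)"
        if "w \<in> ?U" for w vs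
      proof -
        obtain y where y: "y \<in> fst c \<inter> fst d" "w = snd c y" using \<open>w \<in> ?U\<close> by blast
        then have "transition c d w = snd d y" using transition_apply[OF c] by simp
        then show ?thesis using forms_pullback[OF \<omega> c d y(1)] y(2) by simp
      qed
    qed (use x in auto)
    then show ?thesis
      using x by (simp add: dolbeault_eq transition_apply[OF c])
  qed
  show ?thesis
    by (rule formsI[OF nonneg 1 2 3])
qed

lemma dolbeault_anticommute:
  assumes \<omega>: "\<omega> \<in> forms \<A> p q"
  shows "dolbeault b (dolbeault b' \<omega>) = - dolbeault b' (dolbeault b \<omega>)"
proof (intro ext)
  fix c z vs
  show "dolbeault b (dolbeault b' \<omega>) c z vs = (- dolbeault b' (dolbeault b \<omega>)) c z vs"
  proof (cases "c \<in> \<A> \<and> z \<in> snd c ` fst c")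
    case True
    then have c: "c \<in> \<A>" and z: "z \<in> snd c ` fst c" by auto
    obtain K :: "('n list \<times> 'n list) set" and f \<alpha>
      where exp: "wedge_expansion (snd c ` fst c) K f \<alpha> (\<omega> c)"
      using forms_expansion[OF \<omega> c] by blast
    have "local_dolbeault b (dolbeault b' \<omega> c) z vs = - local_dolbeault b' (dolbeault b \<omega> c) z vs"
      by (rule local_dolbeault_anticommute[OF exp chart_image_open[OF c] z]) (simp_all add: dolbeault_eq)
    then show ?thesis
      using z by (simp add: dolbeault_eq)
  next
    case False
    \<comment> \<open>Off the chart image the cut-off gives 0, and for charts outside the atlas the
      form itself vanishes.\<close>
    have "dolbeault b (dolbeault b' \<omega>) c z vs = 0" for b b'
    proof (cases "c \<in> \<A>")
      case True
      then show ?thesis using False by (simp add: dolbeault_eq)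
    next
      case c: False
      show ?thesis
        using forms_outside[OF dolbeault_forms[OF \<omega>] c, of b']
        by (simp add: dolbeault_eq local_dolbeault_zero)
    qed
    then show ?thesis by simp
  qed
qed

lemma dolbeault_add:
  assumes \<omega>: "\<omega> \<in> forms \<A> p q" and \<eta>: "\<eta> \<in> forms \<A> p q"
  shows "dolbeault b (\<omega> + \<eta>) = dolbeault b \<omega> + dolbeault b \<eta>"
proof (intro ext)
  fix c z vs
  have "wirtinger b i (\<lambda>w. \<omega> c w us + \<eta> c w us) z =
      wirtinger b i (\<lambda>w. \<omega> c w us) z + wirtinger b i (\<lambda>w. \<eta> c w us) z"
    if z: "z \<in> snd c ` fst c" for i us
  proof (cases "c \<in> \<A>")
    case True
    have "((\<lambda>w. \<omega> c w us + \<eta> c w us) has_derivative (\<lambda>v. frechet_derivative (\<lambda>w. \<omega> c w us) (at z) v +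
        frechet_derivative (\<lambda>w. \<eta> c w us) (at z) v)) (at z)"
      by (intro has_derivative_add has_frechet_derivative forms_differentiable[OF \<omega> True z]
          forms_differentiable[OF \<eta> True z])
    from frechet_derivative_eq[OF this] show ?thesis
      by (simp add: wirtinger_eq algebra_simps add_divide_distrib)
  next
    case False
    then show ?thesis
      using forms_outside[OF \<omega>] forms_outside[OF \<eta>] by (simp add: wirtinger_eq)
  qed
  then show "dolbeault b (\<omega> + \<eta>) c z vs = (dolbeault b \<omega> + dolbeault b \<eta>) c z vs"
    by (simp add: dolbeault_eq local_dolbeault_def sum.distrib algebra_simps)
qed

lemma dolbeault_scale:
  assumes \<omega>: "\<omega> \<in> forms \<A> p q"
  shows "dolbeault b (form_scale a \<omega>) = form_scale a (dolbeault b \<omega>)"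
proof (intro ext)
  fix c z vs
  have "wirtinger b i (\<lambda>w. a * \<omega> c w us) z = a * wirtinger b i (\<lambda>w. \<omega> c w us) z"
    if z: "z \<in> snd c ` fst c" for i us
  proof (cases "c \<in> \<A>")
    case True
    have "((\<lambda>w. a * \<omega> c w us) has_derivative (\<lambda>v. a * frechet_derivative (\<lambda>w. \<omega> c w us) (at z) v)) (at z)"
      by (intro has_derivative_mult_right has_frechet_derivative forms_differentiable[OF \<omega> True z])
    from frechet_derivative_eq[OF this] show ?thesis
      by (simp add: wirtinger_eq algebra_simps add_divide_distrib)
  next
    case False
    then show ?thesis
      using forms_outside[OF \<omega>] by (simp add: wirtinger_eq)
  qed
  then show "dolbeault b (form_scale a \<omega>) c z vs = form_scale a (dolbeault b \<omega>) c z vs"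
    by (simp add: dolbeault_eq form_scale_def local_dolbeault_def sum_distrib_left mult_ac)
qed

lemma forms_add:
  assumes \<omega>: "\<omega> \<in> forms \<A> p q" and \<eta>: "\<eta> \<in> forms \<A> p q"
  shows "\<omega> + \<eta> \<in> forms \<A> p q"
proof (cases "p < 0 \<or> q < 0")
  case True
  then show ?thesis using assms by (simp add: forms_def plus_fun_def)
next
  case False
  have 1: "(\<omega> + \<eta>) c = (\<lambda>z vs. 0)" if "c \<notin> \<A>" for c
    using forms_outside[OF \<omega> that] forms_outside[OF \<eta> that] by (simp add: plus_fun_def)
  have 2: "local_form (nat p) (nat q) (snd c ` fst c) ((\<omega> + \<eta>) c)" if "c \<in> \<A>" for c
    using local_form_add[OF chart_image_open[OF that] forms_local[OF \<omega> False that]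
        forms_local[OF \<eta> False that]] by (simp add: plus_fun_def)
  have 3: "(\<omega> + \<eta>) c (snd c x) vs =
      (\<omega> + \<eta>) d (snd d x) (map (frechet_derivative (transition c d) (at (snd c x))) vs)"
    if "c \<in> \<A>" "d \<in> \<A>" "x \<in> fst c \<inter> fst d" for c d x vs
    using forms_pullback[OF \<omega> that] forms_pullback[OF \<eta> that] by simp
  show ?thesis
    by (rule formsI[OF False 1 2 3])
qed

lemma forms_scale:
  assumes \<omega>: "\<omega> \<in> forms \<A> p q"
  shows "form_scale a \<omega> \<in> forms \<A> p q"
proof (cases "p < 0 \<or> q < 0")
  case True
  then show ?thesis using assms by (simp add: forms_def form_scale_def)
next
  case False
  have 1: "form_scale a \<omega> c = (\<lambda>z vs. 0)" if "c \<notin> \<A>" for c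
    using forms_outside[OF \<omega> that] by (simp add: form_scale_def)
  have 2: "local_form (nat p) (nat q) (snd c ` fst c) (form_scale a \<omega> c)" if "c \<in> \<A>" for c
    using local_form_scale[OF chart_image_open[OF that] forms_local[OF \<omega> False that], of a]
    by (simp add: form_scale_def)
  have 3: "form_scale a \<omega> c (snd c x) vs =
      form_scale a \<omega> d (snd d x) (map (frechet_derivative (transition c d) (at (snd c x))) vs)"
    if "c \<in> \<A>" "d \<in> \<A>" "x \<in> fst c \<inter> fst d" for c d x vs
    using forms_pullback[OF \<omega> that] by (simp add: form_scale_def)
  show ?thesis
    by (rule formsI[OF False 1 2 3])
qed

lemma subspace_forms: "form.subspace (forms \<A> p q)"
  by (intro form.subspaceI zero_forms forms_add forms_scale)

lemma linear_dolbeault: "form.linear_map_on (forms \<A> p q) (dolbeault b)"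
  unfolding form.linear_map_on_def
  using subspace_forms dolbeault_add dolbeault_scale by blast

lemma linear_del: "form.linear_map_on (forms \<A> p q) del"
  and linear_delbar: "form.linear_map_on (forms \<A> p q) delbar"
  using linear_dolbeault[of p q True] linear_dolbeault[of p q False]
  by (simp_all add: dolbeault_def[abs_def])

lemma del_forms: "\<omega> \<in> forms \<A> p q \<Longrightarrow> del \<omega> \<in> forms \<A> (p + 1) q"
  and delbar_forms: "\<omega> \<in> forms \<A> p q \<Longrightarrow> delbar \<omega> \<in> forms \<A> p (q + 1)"
  using dolbeault_forms[of \<omega> p q True] dolbeault_forms[of \<omega> p q False]
  by (simp_all add: dolbeault_def)

lemma del_delbar: "\<omega> \<in> forms \<A> p q \<Longrightarrow> del (delbar \<omega>) = - delbar (del \<omega>)"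
  using dolbeault_anticommute[of \<omega> p q True False] by (simp add: dolbeault_def)

text \<open>Since the operator anticommutes with itself, every value equals its own
  negative.\<close>

lemma dolbeault_dolbeault: 
  assumes "\<omega> \<in> forms \<A> p q"
  shows "dolbeault b (dolbeault b \<omega>) = 0"
proof (intro ext)
  fix c z vs
  have "dolbeault b (dolbeault b \<omega>) c z vs = - dolbeault b (dolbeault b \<omega>) c z vs"
    using arg_cong[OF dolbeault_anticommute[OF assms, of b b], of "\<lambda>\<eta>. \<eta> c z vs"]
    by (simp only: uminus_apply)
  moreover have "x = 0" if "x = - x" for x :: complex
    using that by (simp add: complex_eq_iff)
  ultimately show "dolbeault b (dolbeault b \<omega>) c z vs = 0 c z vs"
    unfolding zero_fun_apply by blast
qed

lemma del_del: "\<omega> \<in> forms \<A> p q \<Longrightarrow> del (del \<omega>) = 0"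
  and delbar_delbar: "\<omega> \<in> forms \<A> p q \<Longrightarrow> delbar (delbar \<omega>) = 0"
  using dolbeault_dolbeault[of \<omega> p q True] dolbeault_dolbeault[of \<omega> p q False]
  by (simp_all add: dolbeault_def)

subsection \<open>Presentations of the cohomology spaces\<close>

lemmas ker_defs = ker_del_def ker_delbar_def ker_del_delbar_def form_space_simps

lemma subspace_zero_form: "form.subspace {0 :: ('a, 'n) form}"
  by (simp add: form.subspace_def)

lemma subspace_ker_del: "form.subspace (ker_del \<A> p q)"
  using form.subspace_preimage_on[OF linear_del subspace_zero_form] by (simp add: ker_defs)

lemma subspace_ker_delbar: "form.subspace (ker_delbar \<A> p q)"
  using form.subspace_preimage_on[OF linear_delbar subspace_zero_form] by (simp add: ker_defs)

lemma ker_del_delbar_eq: "ker_del_delbar \<A> p q = {\<omega> \<in> forms \<A> p q. delbar \<omega> \<in> ker_del \<A> p (q + 1)}"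
  using delbar_forms by (auto simp: ker_defs)

lemma subspace_ker_del_delbar: "form.subspace (ker_del_delbar \<A> p q)"
  unfolding ker_del_delbar_eq by (rule form.subspace_preimage_on[OF linear_delbar subspace_ker_del])

lemma subspace_im_del: "form.subspace (im_del \<A> p q)"
  unfolding im_del_def by (rule form.subspace_image_on[OF linear_del])

lemma subspace_im_delbar: "form.subspace (im_delbar \<A> p q)"
  unfolding im_delbar_def by (rule form.subspace_image_on[OF linear_delbar])

lemma subspace_im_A: "form.subspace (im_del \<A> p q <+>\<^bsub>form_space\<^esub> im_delbar \<A> p q)"
  unfolding form_set_add by (rule form.subspace_sums[OF subspace_im_del subspace_im_delbar])

lemma delbar_del_eq_0_iff:
  assumes "\<omega> \<in> forms \<A> p q"
  shows "delbar (del \<omega>) = 0 \<longleftrightarrow> del (delbar \<omega>) = 0"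
  using del_delbar[OF assms] by (metis minus_equation_iff minus_zero)

lemma im_delbar_subset: "im_delbar \<A> p q \<subseteq> ker_delbar \<A> p q"
  using delbar_forms[of _ p "q - 1"] delbar_delbar[of _ p "q - 1"]
  by (auto simp: im_delbar_def ker_defs)

lemma im_del_subset: "im_del \<A> p q \<subseteq> ker_del \<A> p q"
  using del_forms[of _ "p - 1" q] del_del[of _ "p - 1" q]
  by (auto simp: im_del_def ker_defs)

lemma ker_delbar_subset: "ker_delbar \<A> p q \<subseteq> ker_del_delbar \<A> p q"
  using form.linear_map_on_0[OF linear_del] by (auto simp: ker_defs)

lemma ker_del_subset: "ker_del \<A> p q \<subseteq> ker_del_delbar \<A> p q"
  using form.linear_map_on_0[OF linear_delbar]
  by (auto simp: ker_defs delbar_del_eq_0_iff[symmetric])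

lemma im_A_subset: "im_del \<A> p q <+>\<^bsub>form_space\<^esub> im_delbar \<A> p q \<subseteq> ker_del_delbar \<A> p q"
proof -
  have "x + y \<in> ker_del_delbar \<A> p q" if "x \<in> im_del \<A> p q" "y \<in> im_delbar \<A> p q" for x y
    using that im_del_subset ker_del_subset im_delbar_subset ker_delbar_subset
    by (blast intro: form.subspace_add[OF subspace_ker_del_delbar])
  then show ?thesis unfolding form_set_add by blast
qed

lemma im_del_le_im_A: "x \<in> im_del \<A> p q \<Longrightarrow> x \<in> im_del \<A> p q <+>\<^bsub>form_space\<^esub> im_delbar \<A> p q"
  unfolding form_set_add using form.subset_sums_left[OF subspace_im_delbar] by blast

lemma im_delbar_le_im_A: "x \<in> im_delbar \<A> p q \<Longrightarrow> x \<in> im_del \<A> p q <+>\<^bsub>form_space\<^esub> im_delbar \<A> p q"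
  unfolding form_set_add using form.subset_sums_right[OF subspace_im_del] by blast

lemma H_delbar_presents:
  "form.presents (class_delbar \<A> p q) (ker_delbar \<A> p q) (im_delbar \<A> p q) (H_delbar \<A> p q)"
  using form_presents_quot[OF subspace_ker_delbar subspace_im_delbar im_delbar_subset]
  by (simp add: H_delbar_def class_delbar_def[abs_def])

lemma H_del_presents:
  "form.presents (\<lambda>x. im_del \<A> p q +>\<^bsub>form_space\<^esub> x) (ker_del \<A> p q) (im_del \<A> p q) (H_del \<A> p q)"
  using form_presents_quot[OF subspace_ker_del subspace_im_del im_del_subset]
  by (simp add: H_del_def)

lemma H_A_presents:
  "form.presents (class_A \<A> p q) (ker_del_delbar \<A> p q)
    (im_del \<A> p q <+>\<^bsub>form_space\<^esub> im_delbar \<A> p q) (H_A \<A> p q)"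
  using form_presents_quot[OF subspace_ker_del_delbar subspace_im_A im_A_subset]
  by (simp add: H_A_def class_A_def[abs_def])

lemma ker_forms:
  "x \<in> ker_del \<A> p q \<Longrightarrow> x \<in> forms \<A> p q" "x \<in> ker_delbar \<A> p q \<Longrightarrow> x \<in> forms \<A> p q"
  "x \<in> ker_del_delbar \<A> p q \<Longrightarrow> x \<in> forms \<A> p q"
  by (simp_all add: ker_defs)

text \<open>By anticommutation of the operators. It makes \<partial>\<theta> the representative of a
  Dolbeault class for every Aeppli class of \<theta>.\<close>

lemma del_ker_del_delbar: "\<theta> \<in> ker_del_delbar \<A> p q \<Longrightarrow> del \<theta> \<in> ker_delbar \<A> (p + 1) q"
  using del_forms delbar_del_eq_0_iff by (auto simp: ker_defs)

lemma class_delbar_eq_zero_iff: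
  assumes "x \<in> ker_delbar \<A> p q"
  shows "class_delbar \<A> p q x = \<zero>\<^bsub>H_delbar \<A> p q\<^esub> \<longleftrightarrow> x \<in> im_delbar \<A> p q"
proof -
  have "\<zero>\<^bsub>H_delbar \<A> p q\<^esub> = class_delbar \<A> p q 0"
    by (simp add: H_delbar_def quot_space_def class_delbar_def a_r_coset_def' form_space_simps)
  then show ?thesis
    using form.presentsD(5)[OF H_delbar_presents assms form.subspace_0[OF subspace_ker_delbar]] by simp
qed

text \<open>\<partial>(\<partial>a + \<partial>bar b) = - \<partial>bar\<partial>b. Hence the class
  of \<partial>\<theta> does not depend on the representative, for Dolbeault as well as for Aeppli
  classes.\<close>

lemma del_im_A:
  assumes "x \<in> im_del \<A> p q <+>\<^bsub>form_space\<^esub> im_delbar \<A> p q"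
  shows "del x \<in> im_delbar \<A> (p + 1) q"
proof -
  obtain a b where a: "a \<in> forms \<A> (p - 1) q" and b: "b \<in> forms \<A> p (q - 1)" and x: "x = del a + delbar b"
    using assms unfolding form_set_add im_del_def im_delbar_def by blast
  have mem: "del a \<in> forms \<A> p q" "delbar b \<in> forms \<A> p q"
    using del_forms[OF a] delbar_forms[OF b] by simp_all
  have "del x = del (del a) + del (delbar b)"
    using linear_del[of p q] mem unfolding x form.linear_map_on_def by blast
  also have "\<dots> = - delbar (del b)"
    by (simp add: del_del[OF a] del_delbar[OF b])
  finally have "del x = - delbar (del b)" .
  moreover have "delbar (del b) \<in> im_delbar \<A> (p + 1) q"
    using del_forms[OF b] by (simp add: im_delbar_def)
  ultimately show ?thesis using form.subspace_neg[OF subspace_im_delbar] by simp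
qed

lemma class_delbar_del_cong:
  assumes "\<theta> \<in> ker_del_delbar \<A> p q" "y \<in> ker_del_delbar \<A> p q" "del (y - \<theta>) \<in> im_delbar \<A> (p + 1) q"
  shows "class_delbar \<A> (p + 1) q (del y) = class_delbar \<A> (p + 1) q (del \<theta>)"
proof -
  have "del y - del \<theta> \<in> im_delbar \<A> (p + 1) q"
    using assms(3) form.linear_map_on_diff[OF linear_del ker_forms(3)[OF assms(2)] ker_forms(3)[OF assms(1)]]
    by simp
  then show ?thesis
    using form.presentsD(5)[OF H_delbar_presents] del_ker_del_delbar assms by blast
qed

text \<open>\<open>induced\<close> takes the only element of an image, so the map has to be constant
  on the whole coset; \<open>del_im_A\<close> provides this.\<close>

lemma del_class_class_delbar:
  assumes \<theta>: "\<theta> \<in> ker_delbar \<A> p q"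
  shows "del_class \<A> p q (class_delbar \<A> p q \<theta>) = class_delbar \<A> (p + 1) q (del \<theta>)"
proof -
  have "class_delbar \<A> p q \<theta> = id ` {y \<in> ker_delbar \<A> p q. y - \<theta> \<in> im_delbar \<A> p q}"
    unfolding class_delbar_def by (rule form_coset[OF subspace_ker_delbar subspace_im_delbar im_delbar_subset \<theta>])
  moreover have "class_delbar \<A> (p + 1) q (del (id y)) = class_delbar \<A> (p + 1) q (del \<theta>)"
    if "y \<in> ker_delbar \<A> p q" "y - \<theta> \<in> im_delbar \<A> p q" for y
    unfolding id_apply
    by (rule class_delbar_del_cong[OF subsetD[OF ker_delbar_subset \<theta>]
          subsetD[OF ker_delbar_subset that(1)] del_im_A[OF im_delbar_le_im_A[OF that(2)]]])
  ultimately show ?thesis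
    unfolding del_class_def by (simp only: form.induced_coset[OF \<theta> subspace_im_delbar])
qed

lemma del_class_class_A:
  assumes \<theta>: "\<theta> \<in> ker_del_delbar \<A> p q"
  shows "del_class \<A> p q (class_A \<A> p q \<theta>) = class_delbar \<A> (p + 1) q (del \<theta>)"
proof -
  let ?B = "im_del \<A> p q <+>\<^bsub>form_space\<^esub> im_delbar \<A> p q"
  have "class_A \<A> p q \<theta> = id ` {y \<in> ker_del_delbar \<A> p q. y - \<theta> \<in> ?B}"
    unfolding class_A_def by (rule form_coset[OF subspace_ker_del_delbar subspace_im_A im_A_subset \<theta>])
  moreover have "class_delbar \<A> (p + 1) q (del (id y)) = class_delbar \<A> (p + 1) q (del \<theta>)"
    if "y \<in> ker_del_delbar \<A> p q" "y - \<theta> \<in> ?B" for y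
    unfolding id_apply by (rule class_delbar_del_cong[OF \<theta> that(1) del_im_A[OF that(2)]])
  ultimately show ?thesis
    unfolding del_class_def by (simp only: form.induced_coset[OF \<theta> subspace_im_A])
qed

lemma cal_H_delbar_eq: "cal_H_delbar \<A> p q = class_A \<A> p q ` ker_delbar \<A> p q"
proof -
  have "induced (class_A \<A> p q) (class_delbar \<A> p q \<theta>) = class_A \<A> p q \<theta>" if \<theta>: "\<theta> \<in> ker_delbar \<A> p q" for \<theta>
  proof -
    have "class_delbar \<A> p q \<theta> = id ` {y \<in> ker_delbar \<A> p q. y - \<theta> \<in> im_delbar \<A> p q}"
      unfolding class_delbar_def by (rule form_coset[OF subspace_ker_delbar subspace_im_delbar im_delbar_subset \<theta>])
    moreover have "class_A \<A> p q (id y) = class_A \<A> p q \<theta>"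
      if "y \<in> ker_delbar \<A> p q" "y - \<theta> \<in> im_delbar \<A> p q" for y
      unfolding id_apply
      using form.presentsD(5)[OF H_A_presents] im_delbar_le_im_A ker_delbar_subset that \<theta> by blast
    ultimately show ?thesis
      by (simp only: form.induced_coset[OF \<theta> subspace_im_delbar])
  qed
  then show ?thesis
    unfolding cal_H_delbar_def form.presentsD(2)[OF H_delbar_presents, symmetric]
    by (auto simp: image_image intro!: image_cong)
qed

lemma cal_H_del_eq: "cal_H_del \<A> p q = class_A \<A> p q ` ker_del \<A> p q"
proof -
  have "induced (class_A \<A> p q) (im_del \<A> p q +>\<^bsub>form_space\<^esub> \<theta>) = class_A \<A> p q \<theta>"
    if \<theta>: "\<theta> \<in> ker_del \<A> p q" for \<theta>
  proof -
    have "im_del \<A> p q +>\<^bsub>form_space\<^esub> \<theta> = id ` {y \<in> ker_del \<A> p q. y - \<theta> \<in> im_del \<A> p q}"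
      by (rule form_coset[OF subspace_ker_del subspace_im_del im_del_subset \<theta>])
    moreover have "class_A \<A> p q (id y) = class_A \<A> p q \<theta>"
      if "y \<in> ker_del \<A> p q" "y - \<theta> \<in> im_del \<A> p q" for y
      unfolding id_apply
      using form.presentsD(5)[OF H_A_presents] im_del_le_im_A ker_del_subset that \<theta> by blast
    ultimately show ?thesis
      by (simp only: form.induced_coset[OF \<theta> subspace_im_del])
  qed
  then show ?thesis
    unfolding cal_H_del_def form.presentsD(2)[OF H_del_presents, symmetric]
    by (auto simp: image_image intro!: image_cong)
qed

section \<open>The filtration of the forms representing the kernel\<close>

lemma subspace_ker_del_reps: "form.subspace (ker_del_reps \<A> p q)"
proof -
  have "form.linear_map_on (ker_delbar \<A> p q) del"
    by (rule form.linear_map_on_subset[OF linear_del subspace_ker_delbar])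
      (auto intro: ker_forms(2))
  then show ?thesis
    unfolding ker_del_reps_def by (rule form.subspace_preimage_on[OF _ subspace_im_delbar])
qed

lemma linear_del_ker_del_delbar: "form.linear_map_on (ker_del_delbar \<A> p q) del"
  by (rule form.linear_map_on_subset[OF linear_del subspace_ker_del_delbar])
    (auto intro: ker_forms(3))

lemma subspace_del_ker_del_delbar: "form.subspace (del ` ker_del_delbar \<A> p q)"
  by (rule form.subspace_image_on[OF linear_del_ker_del_delbar])

lemma subspace_del_L_reps: "form.subspace (del_L_reps \<A> p q)"
  unfolding del_L_reps_def
  by (rule form.subspace_sums[OF subspace_im_delbar subspace_del_ker_del_delbar])

lemma subspace_K_num: "form.subspace (K_num \<A> p q)"
  unfolding K_num_def by (rule form.subspace_inter[OF subspace_ker_del subspace_ker_delbar])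

lemma subspace_K_den: "form.subspace (K_den \<A> p q)"
  unfolding K_den_def form_set_add
  by (intro form.subspace_sums form.subspace_inter subspace_ker_del subspace_ker_delbar
      subspace_im_del subspace_im_delbar)

lemma subspace_H_del_reps: "form.subspace (H_del_reps \<A> p q)"
  unfolding H_del_reps_def by (rule form.subspace_sums[OF subspace_del_L_reps subspace_K_num])

lemma im_delbar_le_del_L_reps: "im_delbar \<A> p q \<subseteq> del_L_reps \<A> p q"
  unfolding del_L_reps_def by (rule form.subset_sums_left[OF subspace_del_ker_del_delbar])

lemma del_ker_del_delbar_le_del_L_reps: "del ` ker_del_delbar \<A> (p - 1) q \<subseteq> del_L_reps \<A> p q"
  unfolding del_L_reps_def by (rule form.subset_sums_right[OF subspace_im_delbar])

lemma del_L_reps_le_H_del_reps: "del_L_reps \<A> p q \<subseteq> H_del_reps \<A> p q"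
  unfolding H_del_reps_def by (rule form.subset_sums_left[OF subspace_K_num])

lemma K_num_le_H_del_reps: "K_num \<A> p q \<subseteq> H_del_reps \<A> p q"
  unfolding H_del_reps_def by (rule form.subset_sums_right[OF subspace_del_L_reps])

lemma K_num_le_ker_del_reps: "K_num \<A> p q \<subseteq> ker_del_reps \<A> p q"
  using form.subspace_0[OF subspace_im_delbar]
  by (auto simp: K_num_def ker_del_reps_def ker_del_def form_space_simps)

text \<open>If \<open>x = del a + y\<close> with \<open>x\<close> and \<open>y\<close> closed under
  \<open>delbar\<close>, then \<open>delbar (del a) = 0\<close>, which puts \<open>a\<close> into
  \<open>ker_del_delbar\<close>. The converse is \<open>del_im_A\<close>.\<close>

lemma ker_del_reps_Int_im_A:
  "ker_del_reps \<A> p q \<inter> (im_del \<A> p q <+>\<^bsub>form_space\<^esub> im_delbar \<A> p q) = del_L_reps \<A> p q"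
proof (intro equalityI subsetI)
  fix x assume x: "x \<in> ker_del_reps \<A> p q \<inter> (im_del \<A> p q <+>\<^bsub>form_space\<^esub> im_delbar \<A> p q)"
  then obtain a y where a: "a \<in> forms \<A> (p - 1) q" and y: "y \<in> im_delbar \<A> p q" and eq: "x = del a + y"
    unfolding form_set_add im_del_def by blast
  have "x - y \<in> ker_delbar \<A> p q"
    using x y im_delbar_subset[of p q]
    by (intro form.subspace_diff[OF subspace_ker_delbar]) (auto simp: ker_del_reps_def)
  then have "delbar (del a) = 0"
    using eq by (simp add: ker_delbar_def form_space_simps)
  then have "a \<in> ker_del_delbar \<A> (p - 1) q"
    using a delbar_del_eq_0_iff[OF a] by (simp add: ker_del_delbar_def form_space_simps)
  then show "x \<in> del_L_reps \<A> p q"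
    unfolding del_L_reps_def eq using y add.commute by blast
next
  fix x assume "x \<in> del_L_reps \<A> p q"
  then obtain y a where y: "y \<in> im_delbar \<A> p q" and a: "a \<in> ker_del_delbar \<A> (p - 1) q" and eq: "x = y + del a"
    unfolding del_L_reps_def by blast
  have im: "del a \<in> im_del \<A> p q"
    using ker_forms(3)[OF a] by (simp add: im_del_def)
  have A: "x \<in> im_del \<A> p q <+>\<^bsub>form_space\<^esub> im_delbar \<A> p q"
    unfolding form_set_add eq using y im add.commute by blast
  have "y \<in> ker_delbar \<A> p q" "del a \<in> ker_delbar \<A> p q"
    using y im_delbar_subset del_ker_del_delbar[OF a] by auto
  then have "x \<in> ker_delbar \<A> p q"
    unfolding eq by (rule form.subspace_add[OF subspace_ker_delbar])
  then show "x \<in> ker_del_reps \<A> p q \<inter> (im_del \<A> p q <+>\<^bsub>form_space\<^esub> im_delbar \<A> p q)"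
    using A del_im_A[OF A] by (simp add: ker_del_reps_def)
qed

lemma H_del_reps_le_ker_del_reps: "H_del_reps \<A> p q \<subseteq> ker_del_reps \<A> p q"
  using ker_del_reps_Int_im_A[of p q] K_num_le_ker_del_reps[of p q]
  unfolding H_del_reps_def by (blast intro: form.subspace_add[OF subspace_ker_del_reps])

text \<open>If \<open>x = y + del a\<close> is closed under both operators, then so is
  \<open>y\<close>, because \<open>del a\<close> is. By the second isomorphism theorem this
  identifies the graded piece \<open>D / C\<close> with \<open>K_space\<close>.\<close>

lemma K_num_Int_del_L_reps: "K_num \<A> p q \<inter> del_L_reps \<A> p q = K_den \<A> p q"
proof (intro equalityI subsetI)
  fix x assume x: "x \<in> K_num \<A> p q \<inter> del_L_reps \<A> p q"
  then obtain y a where y: "y \<in> im_delbar \<A> p q" and a: "a \<in> ker_del_delbar \<A> (p - 1) q" and eq: "x = y + del a"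
    unfolding del_L_reps_def by blast
  have da: "del a \<in> im_del \<A> p q \<inter> ker_delbar \<A> p q"
    using ker_forms(3)[OF a] del_ker_del_delbar[OF a] by (simp add: im_del_def)
  then have "x - del a \<in> ker_del \<A> p q"
    using x im_del_subset by (intro form.subspace_diff[OF subspace_ker_del]) (auto simp: K_num_def)
  then have "y \<in> im_delbar \<A> p q \<inter> ker_del \<A> p q" using y eq by simp
  then show "x \<in> K_den \<A> p q"
    unfolding K_den_def form_set_add eq using da add.commute by blast
next
  fix x assume "x \<in> K_den \<A> p q"
  then obtain a y where a: "a \<in> im_del \<A> p q \<inter> ker_delbar \<A> p q" and y: "y \<in> im_delbar \<A> p q \<inter> ker_del \<A> p q"
    and eq: "x = a + y"
    unfolding K_den_def form_set_add by blast
  have "a \<in> K_num \<A> p q" "y \<in> K_num \<A> p q"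
    using a y im_del_subset[of p q] im_delbar_subset[of p q] by (auto simp: K_num_def)
  then have num: "x \<in> K_num \<A> p q"
    unfolding eq by (rule form.subspace_add[OF subspace_K_num])
  have "x \<in> im_del \<A> p q <+>\<^bsub>form_space\<^esub> im_delbar \<A> p q"
    unfolding form_set_add eq using a y by blast
  then show "x \<in> K_num \<A> p q \<inter> del_L_reps \<A> p q"
    using num K_num_le_ker_del_reps ker_del_reps_Int_im_A by blast
qed

lemma K_space_presents:
  "form.presents (\<lambda>x. K_den \<A> p q +>\<^bsub>form_space\<^esub> x) (K_num \<A> p q) (K_den \<A> p q) (K_space \<A> p q)"
proof -
  have "K_den \<A> p q \<subseteq> K_num \<A> p q" using K_num_Int_del_L_reps by blast
  from form_presents_quot[OF subspace_K_num subspace_K_den this] show ?thesis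
    by (simp add: K_space_def K_num_def K_den_def)
qed

lemma ker_del_H_delbar_presents:
  "form.presents (class_delbar \<A> p q) (ker_del_reps \<A> p q) (im_delbar \<A> p q) (ker_del_H_delbar \<A> p q)"
proof -
  have zero: "del_class \<A> p q (class_delbar \<A> p q \<theta>) = \<zero>\<^bsub>H_delbar \<A> (p + 1) q\<^esub> \<longleftrightarrow>
      del \<theta> \<in> im_delbar \<A> (p + 1) q" if \<theta>: "\<theta> \<in> ker_delbar \<A> p q" for \<theta>
    unfolding del_class_class_delbar[OF \<theta>]
    by (rule class_delbar_eq_zero_iff[OF del_ker_del_delbar[OF subsetD[OF ker_delbar_subset \<theta>]]])
  have "{a \<in> carrier (H_delbar \<A> p q). del_class \<A> p q a = \<zero>\<^bsub>H_delbar \<A> (p + 1) q\<^esub>} =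
      class_delbar \<A> p q ` ker_del_reps \<A> p q"
    unfolding form.presentsD(2)[OF H_delbar_presents, symmetric] ker_del_reps_def
    using zero by blast
  moreover have "ker_del_reps \<A> p q \<subseteq> ker_delbar \<A> p q" by (auto simp: ker_del_reps_def)
  ultimately show ?thesis
    using form.presents_restrict[OF H_delbar_presents subspace_ker_del_reps]
    by (simp add: ker_del_H_delbar_def)
qed

lemma cal_G_del_eq:
  "cal_G_del \<A> p q = class_A \<A> p q ` {\<theta> \<in> ker_del_delbar \<A> p q. del \<theta> \<in> im_delbar \<A> (p + 1) q}"
proof -
  have zero: "del_class \<A> p q (class_A \<A> p q \<theta>) = \<zero>\<^bsub>H_delbar \<A> (p + 1) q\<^esub> \<longleftrightarrow>
      del \<theta> \<in> im_delbar \<A> (p + 1) q" if \<theta>: "\<theta> \<in> ker_del_delbar \<A> p q" for \<theta>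
    unfolding del_class_class_A[OF \<theta>]
    by (rule class_delbar_eq_zero_iff[OF del_ker_del_delbar[OF \<theta>]])
  then show ?thesis
    unfolding cal_G_del_def form.presentsD(2)[OF H_A_presents, symmetric] by blast
qed

text \<open>Let \<open>z\<close> be \<open>delbar\<close>-closed and \<open>del g\<close> be
  \<open>delbar\<close>-exact, with \<open>z\<close> and \<open>g\<close> in the same Aeppli class.
  Then \<open>del (z - g)\<close> is \<open>delbar\<close>-exact by \<open>del_im_A\<close>, so
  \<open>z\<close> itself lies in \<open>N\<close>.\<close>

lemma cal_H_delbar_Int_cal_G_del: "cal_H_delbar \<A> p q \<inter> cal_G_del \<A> p q = class_A \<A> p q ` ker_del_reps \<A> p q"
proof (intro equalityI subsetI)
  fix m assume "m \<in> cal_H_delbar \<A> p q \<inter> cal_G_del \<A> p q"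
  then obtain z g where z: "z \<in> ker_delbar \<A> p q" and g: "g \<in> ker_del_delbar \<A> p q" "del g \<in> im_delbar \<A> (p + 1) q"
    and m: "m = class_A \<A> p q z" "m = class_A \<A> p q g"
    unfolding cal_H_delbar_eq cal_G_del_eq by blast
  have "z \<in> ker_del_delbar \<A> p q" using z ker_delbar_subset by blast
  then have "z - g \<in> im_del \<A> p q <+>\<^bsub>form_space\<^esub> im_delbar \<A> p q"
    using m form.presentsD(5)[OF H_A_presents _ g(1)] by metis
  from del_im_A[OF this] have "del z - del g \<in> im_delbar \<A> (p + 1) q"
    using form.linear_map_on_diff[OF linear_del ker_forms(2)[OF z] ker_forms(3)[OF g(1)]] by simp
  from form.subspace_add[OF subspace_im_delbar this g(2)] have "z \<in> ker_del_reps \<A> p q"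
    using z by (simp add: ker_del_reps_def)
  then show "m \<in> class_A \<A> p q ` ker_del_reps \<A> p q" using m by blast
next
  fix m assume "m \<in> class_A \<A> p q ` ker_del_reps \<A> p q"
  then show "m \<in> cal_H_delbar \<A> p q \<inter> cal_G_del \<A> p q"
    unfolding cal_H_delbar_eq cal_G_del_eq ker_del_reps_def
    using ker_delbar_subset by blast
qed

text \<open>From \<open>z - k = a + b\<close> the form \<open>z - b = k + a\<close> is closed under
  both operators and has the Aeppli class of \<open>z\<close>. Conversely, the summand in
  \<open>del_L_reps\<close> has class zero, which leaves a form closed under both.\<close>

lemma cal_H_delbar_Int_cal_H_del: "cal_H_delbar \<A> p q \<inter> cal_H_del \<A> p q = class_A \<A> p q ` H_del_reps \<A> p q"
proof (intro equalityI subsetI)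
  note cl = form.presentsD(5)[OF H_A_presents]
  fix m assume "m \<in> cal_H_delbar \<A> p q \<inter> cal_H_del \<A> p q"
  then obtain z k where z: "z \<in> ker_delbar \<A> p q" and k: "k \<in> ker_del \<A> p q"
    and m: "m = class_A \<A> p q z" "m = class_A \<A> p q k"
    unfolding cal_H_delbar_eq cal_H_del_eq by blast
  have zA: "z \<in> ker_del_delbar \<A> p q" and kA: "k \<in> ker_del_delbar \<A> p q"
    using z k ker_delbar_subset ker_del_subset by blast+
  have "z - k \<in> im_del \<A> p q <+>\<^bsub>form_space\<^esub> im_delbar \<A> p q"
    using m cl[OF zA kA] by metis
  then obtain a b where a: "a \<in> im_del \<A> p q" and b: "b \<in> im_delbar \<A> p q" and eq: "z - k = a + b"
    unfolding form_set_add by blast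
  have "z - b \<in> ker_delbar \<A> p q"
    using z b im_delbar_subset by (blast intro: form.subspace_diff[OF subspace_ker_delbar])
  moreover have "z - b = k + a" using eq by (simp add: algebra_simps)
  moreover have "k + a \<in> ker_del \<A> p q"
    using k a im_del_subset by (blast intro: form.subspace_add[OF subspace_ker_del])
  ultimately have num: "z - b \<in> K_num \<A> p q" by (simp add: K_num_def)
  then have "z - b \<in> ker_del_delbar \<A> p q"
    using ker_del_subset by (auto simp: K_num_def)
  then have "class_A \<A> p q z = class_A \<A> p q (z - b)"
    using cl[OF zA] im_delbar_le_im_A[OF b] by simp
  then show "m \<in> class_A \<A> p q ` H_del_reps \<A> p q"
    using num K_num_le_H_del_reps m by blast
next
  note cl = form.presentsD(5)[OF H_A_presents]
  fix m assume "m \<in> class_A \<A> p q ` H_del_reps \<A> p q"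
  then obtain c k where c: "c \<in> del_L_reps \<A> p q" and k: "k \<in> K_num \<A> p q" and m: "m = class_A \<A> p q (c + k)"
    unfolding H_del_reps_def by blast
  have cA: "c \<in> im_del \<A> p q <+>\<^bsub>form_space\<^esub> im_delbar \<A> p q"
    using c ker_del_reps_Int_im_A by blast
  have kA: "k \<in> ker_del_delbar \<A> p q"
    using k ker_del_subset by (auto simp: K_num_def)
  have "c + k \<in> ker_del_delbar \<A> p q"
    using form.subspace_add[OF subspace_ker_del_delbar _ kA] cA im_A_subset by blast
  then have "m = class_A \<A> p q k"
    using cl[OF _ kA] cA m by simp
  then show "m \<in> cal_H_delbar \<A> p q \<inter> cal_H_del \<A> p q"
    unfolding cal_H_delbar_eq cal_H_del_eq using k by (auto simp: K_num_def)
qed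

lemma G_del_sqcap_H_delbar_presents:
  "\<exists>g. form.presents g (ker_del_reps \<A> p q) (H_del_reps \<A> p q) (G_del_sqcap_H_delbar \<A> p q)"
proof -
  have "ker_del_reps \<A> p q \<subseteq> ker_del_delbar \<A> p q"
    using ker_delbar_subset by (auto simp: ker_del_reps_def)
  note pres = form.presents_restrict[OF H_A_presents subspace_ker_del_reps this]
  have "ker_del_reps \<A> p q \<inter> (im_del \<A> p q <+>\<^bsub>form_space\<^esub> im_delbar \<A> p q) \<subseteq> H_del_reps \<A> p q"
    using ker_del_reps_Int_im_A del_L_reps_le_H_del_reps by blast
  from form.presents_quot_space[OF pres subspace_H_del_reps H_del_reps_le_ker_del_reps this] show ?thesis
    unfolding G_del_sqcap_H_delbar_def cal_H_delbar_Int_cal_G_del cal_H_delbar_Int_cal_H_del by blast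
qed

text \<open>Elements of \<open>L_del\<close> are cosets of Aeppli classes. On forms, such a coset
  consists of those \<open>y\<close> whose difference from \<open>\<eta>\<close> has a
  \<open>delbar\<close>-exact image under \<open>del\<close>, and on these the class of
  \<open>del y\<close> is constant.\<close>

lemma induced_del_class_L:
  assumes \<eta>: "\<eta> \<in> ker_del_delbar \<A> p q"
  shows "induced (del_class \<A> p q) (cal_G_del \<A> p q +>\<^bsub>H_A \<A> p q\<^esub> class_A \<A> p q \<eta>) =
    class_delbar \<A> (p + 1) q (del \<eta>)"
proof -
  let ?G = "{\<theta> \<in> ker_del_delbar \<A> p q. del \<theta> \<in> im_delbar \<A> (p + 1) q}"
  have G: "form.subspace ?G"
    by (rule form.subspace_preimage_on[OF linear_del_ker_del_delbar subspace_im_delbar])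
  have "cal_G_del \<A> p q +>\<^bsub>H_A \<A> p q\<^esub> class_A \<A> p q \<eta> =
      class_A \<A> p q ` {y \<in> ker_del_delbar \<A> p q. y - \<eta> \<in> ?G}"
    unfolding cal_G_del_eq by (rule form.presents_coset[OF H_A_presents G _ \<eta>]) blast
  moreover have "del_class \<A> p q (class_A \<A> p q y) = class_delbar \<A> (p + 1) q (del \<eta>)"
    if "y \<in> ker_del_delbar \<A> p q" "y - \<eta> \<in> ?G" for y
    using del_class_class_A[OF that(1)] class_delbar_del_cong[OF \<eta> that(1)] that(2) by simp
  ultimately show ?thesis
    by (simp only: form.induced_coset[OF \<eta> G])
qed

text \<open>The classes of \<open>del\<close> of \<open>ker_del_delbar\<close> already exhaust the
  image. The exact forms are added so that the space of representatives contains
  \<open>im_delbar\<close>, the bottom of the filtration.\<close>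

lemma del_L_del_presents:
  "form.presents (class_delbar \<A> p q) (del_L_reps \<A> p q) (im_delbar \<A> p q) (del_L_del \<A> (p - 1) q)"
proof -
  let ?V = "ker_del_delbar \<A> (p - 1) q"
  have sub: "del_L_reps \<A> p q \<subseteq> ker_delbar \<A> p q"
    using ker_del_reps_Int_im_A by (auto simp: ker_del_reps_def)
  have "carrier (L_del \<A> (p - 1) q) =
      (\<lambda>\<eta>. cal_G_del \<A> (p - 1) q +>\<^bsub>H_A \<A> (p - 1) q\<^esub> class_A \<A> (p - 1) q \<eta>) ` ?V"
    by (auto simp: L_del_def quot_space_def A_RCOSETS_def' form.presentsD(2)[OF H_A_presents, symmetric])
  then have "induced (del_class \<A> (p - 1) q) ` carrier (L_del \<A> (p - 1) q) = class_delbar \<A> p q ` del ` ?V"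
    using induced_del_class_L[of _ "p - 1" q] by (simp add: image_image)
  also have "\<dots> = class_delbar \<A> p q ` del_L_reps \<A> p q"
  proof (intro equalityI subsetI)
    fix m assume "m \<in> class_delbar \<A> p q ` del_L_reps \<A> p q"
    then obtain y a where y: "y \<in> im_delbar \<A> p q" and a: "a \<in> ?V" and m: "m = class_delbar \<A> p q (y + del a)"
      unfolding del_L_reps_def by blast
    have "del a \<in> del_L_reps \<A> p q" "y \<in> del_L_reps \<A> p q"
      using a y del_ker_del_delbar_le_del_L_reps im_delbar_le_del_L_reps by blast+
    then have "y + del a \<in> ker_delbar \<A> p q" "del a \<in> ker_delbar \<A> p q"
      using sub form.subspace_add[OF subspace_del_L_reps] by blast+
    from form.presentsD(5)[OF H_delbar_presents this] y
    have "class_delbar \<A> p q (y + del a) = class_delbar \<A> p q (del a)" by simp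
    then show "m \<in> class_delbar \<A> p q ` del ` ?V" using a m by blast
  qed (use del_ker_del_delbar_le_del_L_reps in blast)
  finally show ?thesis
    using form.presents_restrict[OF H_delbar_presents subspace_del_L_reps sub]
    by (simp add: del_L_del_def)
qed

end

theorem lemma5p4:
  fixes X :: "'a topology" and \<A> :: "('a, 'n::finite) chart set" and p q :: int
  assumes "compact_complex_manifold X \<A>"
  shows "ker_del_H_delbar \<A> p q \<cong>\<^sub>v
    G_del_sqcap_H_delbar \<A> p q \<oplus>\<^sub>v K_space \<A> p q \<oplus>\<^sub>v del_L_del \<A> (p - 1) q"
proof -
  have atlas: "holomorphic_atlas X \<A>"
    using assms by (simp add: compact_complex_manifold_def)
  obtain g where g: "form.presents g (ker_del_reps \<A> p q) (H_del_reps \<A> p q) (G_del_sqcap_H_delbar \<A> p q)"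
    using G_del_sqcap_H_delbar_presents[OF atlas] by blast
  \<comment> \<open>The filtration lemma with \<open>del_L_reps\<close> as \<open>C\<close>,
    \<open>K_num\<close> as \<open>N\<close> and \<open>im_delbar\<close> as \<open>B\<close>. The
    kernel on the left is presented by the same two spaces, \<open>ker_del_reps\<close> and
    \<open>im_delbar\<close>.\<close>
  obtain h where "form.presents h (ker_del_reps \<A> p q) (im_delbar \<A> p q)
      (G_del_sqcap_H_delbar \<A> p q \<oplus>\<^sub>v K_space \<A> p q \<oplus>\<^sub>v del_L_del \<A> (p - 1) q)"
    using form.presents_filtration[OF g[unfolded H_del_reps_def]
        K_space_presents[OF atlas, folded K_num_Int_del_L_reps[OF atlas]]
        del_L_del_presents[OF atlas] im_delbar_le_del_L_reps[OF atlas]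
        H_del_reps_le_ker_del_reps[OF atlas, unfolded H_del_reps_def]] by blast
  then show ?thesis
    by (rule form.presents_iso[OF ker_del_H_delbar_presents[OF atlas]])
qed

end
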